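(* Let $Q=(Q,+)$ be a commutative Moufang loop and let $A=\mathrm{Aut}(Q)$. The isomorphism classes of centrally affine quasigroups over $Q$ (resp. of trimedial quasigroups over $Q$) are in one-to-one correspondence with the elements of the set $$\{(\varphi,\psi,c):\varphi\in X,\ \psi\in Y_\varphi,\ c\in Z_{\varphi,\psi}\},$$ where (1) $X$ is a complete set of orbit representatives of the conjugation action of $A$ on $J\mathrm{Aut}_C(Q)$; (2) for every $\varphi\in X$, $Y_\varphi$ is a complete set of orbit representatives of the conjugation action of $C_A(\varphi)$ on $J\mathrm{Aut}_C(Q)$ (resp. on $J\mathrm{Aut}_C(Q)\cap C_A(\varphi)$); (3) $Z_{\varphi,\psi}$ is a complete set of orbit representatives of the natural action of $C_A(\varphi)\cap C_A(\psi)$ on $Z(Q)/\mathrm{Im}(id-(\varphi+\psi))$, given by $\gamma\cdot(u+I)=\gamma(u)+I$ with $I=\mathrm{Im}(id-(\varphi+\psi))$.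
   Context: A quasigroup is a set with a binary operation all of whose left and right translations are bijections; a loop is a quasigroup with a two-sided neutral element $0$. A loop $Q$ (written additively) is Moufang if it satisfies $x+(y+(x+z))=((x+y)+x)+z$. In a commutative Moufang loop every $x$ has a two-sided inverse $-x$ and $-(x+y)=-x-y$; write $x-y=x+(-y)$, and $J:Q\to Q$, $x\mapsto -x$, which is an automorphism. The center $Z(Q)$ is the set of all elements of $Q$ that commute and associate with all elements of $Q$. A mapping $\alpha:Q\to Q$ is central if $Z(Q)+\alpha(x)=Z(Q)+x$ for every $x\in Q$. $\mathrm{Aut}_C(Q)$ is the group of all central automorphisms of $Q$, and $J\mathrm{Aut}_C(Q)=\{J\alpha:\alpha\in\mathrm{Aut}_C(Q)\}$. For $A=\mathrm{Aut}(Q)$, $C_A(\alpha)$ is the centralizer of $\alpha$ in $A$. Sums and differences of mappings are pointwise: $(id-(\varphi+\psi))(x)=x-(\varphi(x)+\psi(x))$. For $\varphi,\psi\in J\mathrm{Aut}_C(Q)$ the image $I=\mathrm{Im}(id-(\varphi+\psi))$ is a subgroup of the abelian group $Z(Q)$, so the quotient $Z(Q)/I$ makes sense. For automorphisms $\varphi,\psi$ of $(Q,+)$ and $c\in Z(Q)$, let $\mathcal Q(Q,+,\varphi,\psi,c)$ denote the quasigroup $(Q,* )$ with $x*y=\varphi(x)+\psi(y)+c$. A quasigroup $(Q,* )$ is centrally affine over $(Q,+)$ if it equals $\mathcal Q(Q,+,\varphi,\psi,c)$ for some $c\in Z(Q)$ and some automorphisms $\varphi,\psi$ such that $-\varphi$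 and $-\psi$ are central mappings (equivalently $\varphi,\psi\in J\mathrm{Aut}_C(Q)$). The trimedial quasigroups over $Q$ are the centrally affine quasigroups $\mathcal Q(Q,+,\varphi,\psi,c)$ over $Q$ with $\varphi\psi=\psi\varphi$; a quasigroup is trimedial if every three of its elements generate a subquasigroup satisfying $(x*y)*(u*v)=(x*u)*(y*v)$, and by a theorem of Kepka a quasigroup is trimedial if and only if it admits such a form with $\varphi\psi=\psi\varphi$ over some commutative Moufang loop. *)

theory Defs
  imports "HOL-Algebra.Group_Action"
begin

text \<open>
  A loop is given by a \<^typ>\<open>('a, 'b) monoid_scheme\<close>, used only as a set with a binary operation and
  a distinguished element.  The additive notation of loop theory becomes multiplicative:
  \<open>x \<otimes> y\<close> stands for \<open>x + y\<close>, \<open>\<one>\<close> for \<open>0\<close> and \<open>inv x\<close> for \<open>- x\<close>.  In particular, \<^const>\<open>auto\<close>,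
  \<^const>\<open>AutoGroup\<close>, \<^const>\<open>m_inv\<close> and cosets, which do not rely on associativity, are those of
  the library.
\<close>

locale quasigroup =
  fixes S :: "'a set" and f :: "'a \<Rightarrow> 'a \<Rightarrow> 'a"
  assumes left_translation_bij: "x \<in> S \<Longrightarrow> bij_betw (\<lambda>y. f x y) S S"
    and right_translation_bij: "x \<in> S \<Longrightarrow> bij_betw (\<lambda>y. f y x) S S"

locale loop = quasigroup "carrier Q" "mult Q"
  for Q :: "('a, 'b) monoid_scheme" (structure) +
  assumes one_closed: "\<one> \<in> carrier Q"
    and l_one: "x \<in> carrier Q \<Longrightarrow> \<one> \<otimes> x = x"
    and r_one: "x \<in> carrier Q \<Longrightarrow> x \<otimes> \<one> = x"

locale moufang_loop = loop +
  assumes moufang: "\<lbrakk>x \<in> carrier Q; y \<in> carrier Q; z \<in> carrier Q\<rbrakk>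
    \<Longrightarrow> x \<otimes> (y \<otimes> (x \<otimes> z)) = ((x \<otimes> y) \<otimes> x) \<otimes> z"

locale comm_moufang_loop = moufang_loop +
  assumes comm: "\<lbrakk>x \<in> carrier Q; y \<in> carrier Q\<rbrakk> \<Longrightarrow> x \<otimes> y = y \<otimes> x"

definition center :: "('a, 'b) monoid_scheme \<Rightarrow> 'a set"
  where "center Q = {z \<in> carrier Q. \<forall>x\<in>carrier Q. \<forall>y\<in>carrier Q.
    z \<otimes>\<^bsub>Q\<^esub> x = x \<otimes>\<^bsub>Q\<^esub> z \<and>
    (z \<otimes>\<^bsub>Q\<^esub> x) \<otimes>\<^bsub>Q\<^esub> y = z \<otimes>\<^bsub>Q\<^esub> (x \<otimes>\<^bsub>Q\<^esub> y) \<and>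
    (x \<otimes>\<^bsub>Q\<^esub> z) \<otimes>\<^bsub>Q\<^esub> y = x \<otimes>\<^bsub>Q\<^esub> (z \<otimes>\<^bsub>Q\<^esub> y) \<and>
    (x \<otimes>\<^bsub>Q\<^esub> y) \<otimes>\<^bsub>Q\<^esub> z = x \<otimes>\<^bsub>Q\<^esub> (y \<otimes>\<^bsub>Q\<^esub> z)}"

definition central_map :: "('a, 'b) monoid_scheme \<Rightarrow> ('a \<Rightarrow> 'a) \<Rightarrow> bool"
  where "central_map Q \<alpha> \<longleftrightarrow> \<alpha> \<in> carrier Q \<rightarrow> carrier Q \<and>
    (\<forall>x\<in>carrier Q. center Q #>\<^bsub>Q\<^esub> \<alpha> x = center Q #>\<^bsub>Q\<^esub> x)"

definition central_auto :: "('a, 'b) monoid_scheme \<Rightarrow> ('a \<Rightarrow> 'a) set"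
  where "central_auto Q = {\<alpha> \<in> auto Q. central_map Q \<alpha>}"

definition inversion :: "('a, 'b) monoid_scheme \<Rightarrow> 'a \<Rightarrow> 'a"
  where "inversion Q = (\<lambda>x\<in>carrier Q. inv\<^bsub>Q\<^esub> x)"

definition J_central_auto :: "('a, 'b) monoid_scheme \<Rightarrow> ('a \<Rightarrow> 'a) set"
  where "J_central_auto Q = (\<lambda>\<alpha>. compose (carrier Q) (inversion Q) \<alpha>) ` central_auto Q"

text \<open>
  A quasigroup with underlying set \<open>carrier Q\<close> is identified with its operation, extended by
  \<open>undefined\<close> outside of the carrier, so that equality of operations is equality of quasigroups.
\<close>

definition affine_op ::
    "('a, 'b) monoid_scheme \<Rightarrow> ('a \<Rightarrow> 'a) \<Rightarrow> ('a \<Rightarrow> 'a) \<Rightarrow> 'a \<Rightarrow> 'a \<Rightarrow> 'a \<Rightarrow> 'a"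
  where "affine_op Q \<phi> \<psi> c = (\<lambda>x\<in>carrier Q. \<lambda>y\<in>carrier Q. (\<phi> x \<otimes>\<^bsub>Q\<^esub> \<psi> y) \<otimes>\<^bsub>Q\<^esub> c)"

definition centrally_affine_quasigroups :: "('a, 'b) monoid_scheme \<Rightarrow> ('a \<Rightarrow> 'a \<Rightarrow> 'a) set"
  where "centrally_affine_quasigroups Q = {f. quasigroup (carrier Q) f \<and>
    (\<exists>\<phi>\<in>auto Q. \<exists>\<psi>\<in>auto Q. \<exists>c\<in>center Q.
      central_map Q (\<lambda>x. inv\<^bsub>Q\<^esub> (\<phi> x)) \<and> central_map Q (\<lambda>x. inv\<^bsub>Q\<^esub> (\<psi> x)) \<and>
      f = affine_op Q \<phi> \<psi> c)}"

definition trimedial_quasigroups :: "('a, 'b) monoid_scheme \<Rightarrow> ('a \<Rightarrow> 'a \<Rightarrow> 'a) set"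
  where "trimedial_quasigroups Q = {f. quasigroup (carrier Q) f \<and>
    (\<exists>\<phi>\<in>auto Q. \<exists>\<psi>\<in>auto Q. \<exists>c\<in>center Q.
      central_map Q (\<lambda>x. inv\<^bsub>Q\<^esub> (\<phi> x)) \<and> central_map Q (\<lambda>x. inv\<^bsub>Q\<^esub> (\<psi> x)) \<and>
      compose (carrier Q) \<phi> \<psi> = compose (carrier Q) \<psi> \<phi> \<and>
      f = affine_op Q \<phi> \<psi> c)}"

definition quasigroup_isomorphic :: "'a set \<Rightarrow> ('a \<Rightarrow> 'a \<Rightarrow> 'a) \<Rightarrow> ('a \<Rightarrow> 'a \<Rightarrow> 'a) \<Rightarrow> bool"
  where "quasigroup_isomorphic S f g \<longleftrightarrow>
    (\<exists>h. bij_betw h S S \<and> (\<forall>x\<in>S. \<forall>y\<in>S. h (f x y) = g (h x) (h y)))"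

definition isomorphism_classes :: "'a set \<Rightarrow> ('a \<Rightarrow> 'a \<Rightarrow> 'a) set \<Rightarrow> ('a \<Rightarrow> 'a \<Rightarrow> 'a) set set"
  where "isomorphism_classes S \<K> = \<K> // {(f, g). f \<in> \<K> \<and> g \<in> \<K> \<and> quasigroup_isomorphic S f g}"

definition centralizer :: "('a, 'b) monoid_scheme \<Rightarrow> 'a \<Rightarrow> 'a set"
  where "centralizer G a = {g \<in> carrier G. g \<otimes>\<^bsub>G\<^esub> a = a \<otimes>\<^bsub>G\<^esub> g}"

definition conjugation :: "('a, 'b) monoid_scheme \<Rightarrow> 'a set \<Rightarrow> 'a \<Rightarrow> 'a \<Rightarrow> 'a"
  where "conjugation G E = (\<lambda>g. \<lambda>x\<in>E. (g \<otimes>\<^bsub>G\<^esub> x) \<otimes>\<^bsub>G\<^esub> inv\<^bsub>G\<^esub> g)"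

definition orbit_representatives ::
    "('a, 'b) monoid_scheme \<Rightarrow> 'c set \<Rightarrow> ('a \<Rightarrow> 'c \<Rightarrow> 'c) \<Rightarrow> 'c set \<Rightarrow> bool"
  where "orbit_representatives G E act R \<longleftrightarrow> R \<subseteq> E \<and> (\<forall>\<O>\<in>orbits G E act. \<exists>!r. r \<in> R \<and> r \<in> \<O>)"

text \<open>The image of \<open>id - (\<phi> + \<psi>)\<close>.\<close>

definition diff_image :: "('a, 'b) monoid_scheme \<Rightarrow> ('a \<Rightarrow> 'a) \<Rightarrow> ('a \<Rightarrow> 'a) \<Rightarrow> 'a set"
  where "diff_image Q \<phi> \<psi> = (\<lambda>x. x \<otimes>\<^bsub>Q\<^esub> inv\<^bsub>Q\<^esub> (\<phi> x \<otimes>\<^bsub>Q\<^esub> \<psi> x)) ` carrier Q"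

definition center_quotient :: "('a, 'b) monoid_scheme \<Rightarrow> 'a set \<Rightarrow> 'a set set"
  where "center_quotient Q I = carrier (Q\<lparr>carrier := center Q\<rparr> Mod I)"

text \<open>
  The action \<open>\<gamma> \<cdot> (u + I) = \<gamma>(u) + I\<close>.  The union over all representatives \<open>u\<close> of the coset \<open>C\<close>
  is that of a single coset whenever the action is well defined.
\<close>

definition quotient_action ::
    "('a, 'b) monoid_scheme \<Rightarrow> 'a set \<Rightarrow> ('a \<Rightarrow> 'a) \<Rightarrow> 'a set \<Rightarrow> 'a set"
  where "quotient_action Q I = (\<lambda>\<gamma>. \<lambda>C\<in>center_quotient Q I. \<Union>u\<in>C. I #>\<^bsub>Q\<^esub> \<gamma> u)"

text \<open>
  The parameters \<open>(\<phi>, \<psi>, C)\<close> correspond to the isomorphism classes in \<open>\<K>\<close>: the third parameter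
  is a coset of \<open>Im (id - (\<phi> + \<psi>))\<close>, and the class attached to \<open>(\<phi>, \<psi>, C)\<close> is that of the
  affine quasigroup given by \<open>\<phi>\<close>, \<open>\<psi>\<close> and any representative of \<open>C\<close>.
\<close>

definition classifies ::
    "('a, 'b) monoid_scheme \<Rightarrow> (('a \<Rightarrow> 'a) \<times> ('a \<Rightarrow> 'a) \<times> 'a set) set \<Rightarrow> ('a \<Rightarrow> 'a \<Rightarrow> 'a) set \<Rightarrow> bool"
  where "classifies Q T \<K> \<longleftrightarrow>
    (\<exists>F. bij_betw F T (isomorphism_classes (carrier Q) \<K>) \<and>
      (\<forall>(\<phi>, \<psi>, C)\<in>T. \<forall>c\<in>C. affine_op Q \<phi> \<psi> c \<in> F (\<phi>, \<psi>, C)))"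

end

theory Submission
  imports Defs
begin

text \<open>
  A member of \<open>J_central_auto Q\<close> acts as inversion modulo the center: it is an automorphism \<open>\<phi>\<close>
  such that \<open>\<phi> x \<otimes> x\<close> is always central.  Two facts about a commutative Moufang loop make affine
  operations with such coefficients tractable: the identity \<open>(x\<otimes>x) \<otimes> (y\<otimes>z) = (x\<otimes>y) \<otimes> (x\<otimes>z)\<close>, and the
  centrality of cubes.  In the additive notation of loop theory, put \<open>d u = u - (\<phi> u + \<psi> u)\<close>, so that
  the image of \<open>d\<close> is the subgroup \<open>I\<close> divided out of the center.  Up to a central summand, \<open>\<phi> u\<close> and
  \<open>\<psi> u\<close> are both \<open>- u\<close>, so \<open>d u\<close> is \<open>3u\<close> up to a central summand, hence central, and
  \<open>(a + \<phi> u) + (b + \<psi> u) + d u = (a + b) + u\<close> (\<open>displacement_translate\<close>).  Thus the translation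
  by any \<open>u\<close> is an isomorphism from the affine quasigroup with data \<open>(\<phi>, \<psi>, c)\<close> onto the one with data
  \<open>(\<phi>, \<psi>, c + d u)\<close>.

  Consequently every isomorphism between two such quasigroups may be corrected by a translation so as
  to fix the neutral element.  A corrected isomorphism is an automorphism \<open>\<gamma>\<close> of the loop
  (\<open>unital_isomorphism_auto\<close>), and it conjugates the coefficients.  Hence \<open>(\<phi>, \<psi>, c)\<close> and
  \<open>(\<phi>', \<psi>', c')\<close> give isomorphic quasigroups precisely when some \<open>\<gamma>\<close> conjugates \<open>\<phi>\<close> to \<open>\<phi>'\<close> and \<open>\<psi>\<close> to
  \<open>\<psi>'\<close> and carries \<open>c\<close> into the coset of \<open>c'\<close> (\<open>affine_op_isomorphic_iff\<close>).

  What remains is the classification of triples under one group by successive choices: normalize \<open>\<phi>\<close>,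
  then \<open>\<psi>\<close> by what still fixes \<open>\<phi>\<close>, then the coset by what still fixes both.  The centrally affine
  and the trimedial case differ only in the set of admissible \<open>\<psi>\<close> over a given \<open>\<phi>\<close>, so both are
  instances of \<open>affine_quasigroups_classified\<close>.
\<close>

section \<open>Inverses and the square identity in commutative Moufang loops\<close>

context comm_moufang_loop
begin

lemma m_closed [simp, intro]: "\<lbrakk>x \<in> carrier Q; y \<in> carrier Q\<rbrakk> \<Longrightarrow> x \<otimes> y \<in> carrier Q"
  using left_translation_bij[of x] by (auto simp: bij_betw_def)

lemma one_carrier [simp, intro]: "\<one> \<in> carrier Q"
  by (rule one_closed)

lemma l_cancel:
  assumes "x \<otimes> y = x \<otimes> z" "x \<in> carrier Q" "y \<in> carrier Q" "z \<in> carrier Q"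
  shows "y = z"
  using left_translation_bij[of x] assms by (auto simp: bij_betw_def inj_on_def)

lemma l_div_exists:
  assumes "x \<in> carrier Q" "y \<in> carrier Q"
  obtains z where "z \<in> carrier Q" "x \<otimes> z = y"
proof -
  have "y \<in> (\<lambda>y. x \<otimes> y) ` carrier Q"
    using left_translation_bij[of x] assms by (simp add: bij_betw_def)
  then show thesis using that by blast
qed

lemma inv_eqI:
  assumes "x \<in> carrier Q" "y \<in> carrier Q" "x \<otimes> y = \<one>"
  shows "inv x = y"
  unfolding m_inv_def
proof (rule the_equality)
  show "y \<in> carrier Q \<and> x \<otimes> y = \<one> \<and> y \<otimes> x = \<one>"
    using assms comm by simp
  show "z = y" if "z \<in> carrier Q \<and> x \<otimes> z = \<one> \<and> z \<otimes> x = \<one>" for z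
    using l_cancel[of x z y] that assms by simp
qed

lemma inv_closed [simp, intro]: "x \<in> carrier Q \<Longrightarrow> inv x \<in> carrier Q"
  using l_div_exists[of x \<one>] inv_eqI[of x] by (metis one_carrier)

lemma r_inv [simp]: "x \<in> carrier Q \<Longrightarrow> x \<otimes> inv x = \<one>"
  using l_div_exists[of x \<one>] inv_eqI[of x] by (metis one_carrier)

lemma l_inv [simp]: "x \<in> carrier Q \<Longrightarrow> inv x \<otimes> x = \<one>"
  using comm[of "inv x" x] by simp

lemma inv_inv [simp]: "x \<in> carrier Q \<Longrightarrow> inv (inv x) = x"
  by (rule inv_eqI) auto

lemma inv_one [simp]: "inv \<one> = \<one>"
  by (rule inv_eqI) (auto simp: l_one)

text \<open>
  The Moufang law at \<open>y = inv x\<close> reads \<open>x \<otimes> (inv x \<otimes> (x \<otimes> z)) = x \<otimes> z\<close>; cancel \<open>x\<close>.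
\<close>

lemma inv_l_cancel [simp]:
  assumes "x \<in> carrier Q" "y \<in> carrier Q"
  shows "inv x \<otimes> (x \<otimes> y) = y"
  using moufang[of x "inv x" y] assms
  by - (rule l_cancel[of x _ y], auto simp: l_one)

lemma l_inv_cancel [simp]: "\<lbrakk>x \<in> carrier Q; y \<in> carrier Q\<rbrakk> \<Longrightarrow> x \<otimes> (inv x \<otimes> y) = y"
  using inv_l_cancel[of "inv x" y] by simp

lemma r_inv_cancel [simp]: "\<lbrakk>x \<in> carrier Q; y \<in> carrier Q\<rbrakk> \<Longrightarrow> (y \<otimes> inv x) \<otimes> x = y"
  using l_inv_cancel[of x y] by (simp add: comm)

lemma inv_r_cancel [simp]: "\<lbrakk>x \<in> carrier Q; y \<in> carrier Q\<rbrakk> \<Longrightarrow> (y \<otimes> x) \<otimes> inv x = y"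
  using inv_l_cancel[of x y] by (simp add: comm)

lemma inv_mult:
  assumes "x \<in> carrier Q" "y \<in> carrier Q"
  shows "inv (x \<otimes> y) = inv x \<otimes> inv y"
proof -
  have "inv (x \<otimes> y) \<otimes> x = inv y"
    using inv_l_cancel[of "x \<otimes> y" "inv y"] assms by simp
  then have "inv y \<otimes> inv x = inv (x \<otimes> y)"
    using inv_r_cancel[of x "inv (x \<otimes> y)"] assms by simp
  then show ?thesis using assms comm by simp
qed

lemma l_alternative: "\<lbrakk>x \<in> carrier Q; y \<in> carrier Q\<rbrakk> \<Longrightarrow> (x \<otimes> x) \<otimes> y = x \<otimes> (x \<otimes> y)"
  using moufang[of x \<one> y] by (simp add: l_one r_one)

text \<open>
  The Moufang law as an autotopism: writing \<open>L x\<close> for the translation by \<open>x\<close>, the triple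
  \<open>(L (x \<otimes> x), L (inv x), L x)\<close> respects products.  The next two structural facts come from composing
  such triples.
\<close>

lemma moufang_autotopism:
  assumes "x \<in> carrier Q" "y \<in> carrier Q" "z \<in> carrier Q"
  shows "((x \<otimes> x) \<otimes> y) \<otimes> (inv x \<otimes> z) = x \<otimes> (y \<otimes> z)"
  using moufang[of x y "inv x \<otimes> z"] assms by (simp add: l_alternative comm[of "x \<otimes> y" x])

text \<open>
  By commutativity the first two components of \<open>moufang_autotopism\<close> may be exchanged.  The composite
  of both versions is \<open>(L x, L x, L (x \<otimes> x))\<close>.
\<close>

lemma square_mult:
  assumes "x \<in> carrier Q" "y \<in> carrier Q" "z \<in> carrier Q"
  shows "(x \<otimes> x) \<otimes> (y \<otimes> z) = (x \<otimes> y) \<otimes> (x \<otimes> z)"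
proof -
  have "x \<otimes> (y \<otimes> z) = (inv x \<otimes> y) \<otimes> ((x \<otimes> x) \<otimes> z)"
    using moufang_autotopism[of x z y] assms by (simp add: comm)
  then have "x \<otimes> (x \<otimes> (y \<otimes> z)) = x \<otimes> ((inv x \<otimes> y) \<otimes> ((x \<otimes> x) \<otimes> z))"
    by simp
  also have "\<dots> = ((x \<otimes> x) \<otimes> (inv x \<otimes> y)) \<otimes> (inv x \<otimes> ((x \<otimes> x) \<otimes> z))"
    using moufang_autotopism[of x "inv x \<otimes> y" "(x \<otimes> x) \<otimes> z"] assms by simp
  also have "\<dots> = (x \<otimes> y) \<otimes> (x \<otimes> z)"
    using assms by (simp add: l_alternative)
  finally show ?thesis using assms by (simp add: l_alternative)
qed

section \<open>The center, which contains all cubes\<close>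

text \<open>
  By commutativity, associating from the left is enough to be central.
\<close>

lemma center_iff: "z \<in> center Q \<longleftrightarrow>
  z \<in> carrier Q \<and> (\<forall>x\<in>carrier Q. \<forall>y\<in>carrier Q. z \<otimes> (x \<otimes> y) = (z \<otimes> x) \<otimes> y)"
  (is "?l \<longleftrightarrow> ?r")
proof
  assume ?r
  then have z: "z \<in> carrier Q"
    and zl: "\<And>x y. \<lbrakk>x \<in> carrier Q; y \<in> carrier Q\<rbrakk> \<Longrightarrow> (z \<otimes> x) \<otimes> y = z \<otimes> (x \<otimes> y)"
    by auto
  have zr: "x \<otimes> (z \<otimes> y) = z \<otimes> (x \<otimes> y)" if "x \<in> carrier Q" "y \<in> carrier Q" for x y
    using zl[of y x] comm[of x "z \<otimes> y"] comm[of x y] z that by simp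
  have "z \<otimes> x = x \<otimes> z \<and> (z \<otimes> x) \<otimes> y = z \<otimes> (x \<otimes> y) \<and>
      (x \<otimes> z) \<otimes> y = x \<otimes> (z \<otimes> y) \<and> (x \<otimes> y) \<otimes> z = x \<otimes> (y \<otimes> z)"
    if "x \<in> carrier Q" "y \<in> carrier Q" for x y
    using that z by (simp add: zl zr comm[of x z] comm[of y z] comm[of "x \<otimes> y" z])
  then show ?l unfolding center_def using z by blast
next
  assume ?l
  then have "z \<in> carrier Q" "\<forall>x\<in>carrier Q. \<forall>y\<in>carrier Q. (z \<otimes> x) \<otimes> y = z \<otimes> (x \<otimes> y)"
    unfolding center_def by blast+
  then show ?r by simp
qed

lemma center_carrier [simp]: "z \<in> center Q \<Longrightarrow> z \<in> carrier Q"
  by (simp add: center_def)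

lemma center_assoc:
  "\<lbrakk>z \<in> center Q; x \<in> carrier Q; y \<in> carrier Q\<rbrakk> \<Longrightarrow> (z \<otimes> x) \<otimes> y = z \<otimes> (x \<otimes> y)"
  using center_iff[of z] by metis

lemma center_lcomm:
  "\<lbrakk>z \<in> center Q; x \<in> carrier Q; y \<in> carrier Q\<rbrakk> \<Longrightarrow> x \<otimes> (z \<otimes> y) = z \<otimes> (x \<otimes> y)"
  using center_assoc[of z y x] comm[of x "z \<otimes> y"] comm[of x y] by simp

lemma center_rassoc:
  "\<lbrakk>z \<in> center Q; x \<in> carrier Q; y \<in> carrier Q\<rbrakk> \<Longrightarrow> (x \<otimes> y) \<otimes> z = x \<otimes> (y \<otimes> z)"
  using center_lcomm[of z x y] comm[of y z] comm[of "x \<otimes> y" z] by simp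

lemma one_center [simp]: "\<one> \<in> center Q"
  unfolding center_iff by (simp add: l_one)

lemma center_mult [simp]:
  assumes "z \<in> center Q" "w \<in> center Q" shows "z \<otimes> w \<in> center Q"
  unfolding center_iff using assms by (simp add: center_assoc)

lemma center_inv [simp]:
  assumes "z \<in> center Q" shows "inv z \<in> center Q"
proof -
  have "inv z \<otimes> (x \<otimes> y) = (inv z \<otimes> x) \<otimes> y" if "x \<in> carrier Q" "y \<in> carrier Q" for x y
    using center_assoc[OF assms, of "inv z \<otimes> x" y] assms that
    by - (rule l_cancel[of z], auto)
  then show ?thesis unfolding center_iff using assms by simp
qed

lemma center_comm_group: "comm_group (Q\<lparr>carrier := center Q\<rparr>)"
proof (rule comm_groupI)
  show "\<exists>y\<in>carrier (Q\<lparr>carrier := center Q\<rparr>). y \<otimes>\<^bsub>Q\<lparr>carrier := center Q\<rparr>\<^esub> x = \<one>\<^bsub>Q\<lparr>carrier := center Q\<rparr>\<^esub>"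
    if "x \<in> carrier (Q\<lparr>carrier := center Q\<rparr>)" for x
    using that by (auto intro!: bexI[of _ "inv x"])
qed (auto simp: center_assoc l_one intro: comm[OF center_carrier center_carrier])

text \<open>
  The composite of the autotopisms \<open>(L x, L x, L (x \<otimes> x))\<close> of \<open>square_mult\<close> and
  \<open>(L (x \<otimes> x), L (inv x), L x)\<close> of \<open>moufang_autotopism\<close> is the cube of \<open>L x\<close> in the first and third
  component and the identity in the second, which says that the cube of \<open>x\<close> associates from the left.
\<close>

lemma cube_central:
  assumes "x \<in> carrier Q" shows "x \<otimes> (x \<otimes> x) \<in> center Q"
proof -
  have cube: "(x \<otimes> (x \<otimes> x)) \<otimes> y = x \<otimes> (x \<otimes> (x \<otimes> y))" if "y \<in> carrier Q" for y
    using moufang[of x x y] comm[of "x \<otimes> x" x] assms that by simp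
  show ?thesis
    unfolding center_iff
  proof (intro conjI ballI)
    fix y z assume yz: "y \<in> carrier Q" "z \<in> carrier Q"
    have "x \<otimes> (x \<otimes> (x \<otimes> (y \<otimes> z))) = x \<otimes> (x \<otimes> (((x \<otimes> x) \<otimes> y) \<otimes> (inv x \<otimes> z)))"
      using moufang_autotopism[of x y z] assms yz by simp
    also have "\<dots> = (x \<otimes> ((x \<otimes> x) \<otimes> y)) \<otimes> (x \<otimes> (inv x \<otimes> z))"
      using square_mult[of x "(x \<otimes> x) \<otimes> y" "inv x \<otimes> z"] assms yz by (simp add: l_alternative)
    finally show "(x \<otimes> (x \<otimes> x)) \<otimes> (y \<otimes> z) = ((x \<otimes> (x \<otimes> x)) \<otimes> y) \<otimes> z"
      using assms yz by (simp add: cube l_alternative)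
  qed (use assms in auto)
qed

section \<open>The automorphism group and conjugation\<close>

lemma auto_iff: "f \<in> auto Q \<longleftrightarrow>
    f \<in> extensional (carrier Q) \<and> bij_betw f (carrier Q) (carrier Q) \<and>
    (\<forall>x\<in>carrier Q. \<forall>y\<in>carrier Q. f (x \<otimes> y) = f x \<otimes> f y)"
  unfolding auto_def hom_def Bij_def by (auto dest: bij_betw_imp_funcset)

lemma auto_closed [simp]: "\<lbrakk>f \<in> auto Q; x \<in> carrier Q\<rbrakk> \<Longrightarrow> f x \<in> carrier Q"
  by (auto simp: auto_iff bij_betw_def)

lemma auto_mult: "\<lbrakk>f \<in> auto Q; x \<in> carrier Q; y \<in> carrier Q\<rbrakk> \<Longrightarrow> f (x \<otimes> y) = f x \<otimes> f y"
  by (simp add: auto_iff)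

lemma auto_inj:
  "\<lbrakk>f x = f y; f \<in> auto Q; x \<in> carrier Q; y \<in> carrier Q\<rbrakk> \<Longrightarrow> x = y"
  unfolding auto_iff bij_betw_def by (blast dest: inj_onD)

lemma auto_surj:
  assumes "f \<in> auto Q" "y \<in> carrier Q"
  obtains x where "x \<in> carrier Q" "f x = y"
proof -
  have "bij_betw f (carrier Q) (carrier Q)" using assms(1) unfolding auto_iff by (elim conjE)
  then have "y \<in> f ` carrier Q" using assms(2) by (simp only: bij_betw_imp_surj_on)
  then show thesis by (elim imageE) (rule that, simp_all only:)
qed

lemma auto_eqI:
  "\<lbrakk>f \<in> auto Q; g \<in> auto Q; \<And>x. x \<in> carrier Q \<Longrightarrow> f x = g x\<rbrakk> \<Longrightarrow> f = g"
  by (rule extensionalityI[of f "carrier Q" g]) (auto simp only: auto_iff)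

lemma auto_one [simp]:
  assumes "f \<in> auto Q" shows "f \<one> = \<one>"
proof (rule l_cancel)
  show "f \<one> \<otimes> f \<one> = f \<one> \<otimes> \<one>"
    using assms by (simp add: auto_mult[OF assms, symmetric] l_one r_one)
qed (use assms in auto)

lemma auto_inv:
  assumes "f \<in> auto Q" "x \<in> carrier Q" shows "f (inv x) = inv (f x)"
  using auto_mult[OF assms(1), of x "inv x"] assms by (intro inv_eqI[symmetric]) auto

lemma auto_center [simp]:
  assumes f: "f \<in> auto Q" and z: "z \<in> center Q" shows "f z \<in> center Q"
  unfolding center_iff
proof (intro conjI ballI)
  fix x y assume "x \<in> carrier Q" "y \<in> carrier Q"
  then obtain x' y' where "x' \<in> carrier Q" "f x' = x" "y' \<in> carrier Q" "f y' = y"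
    using auto_surj[OF f] by metis
  then show "f z \<otimes> (x \<otimes> y) = (f z \<otimes> x) \<otimes> y"
    using f z center_assoc[of z x' y'] by (auto simp: auto_mult[symmetric])
qed (use f z in auto)

lemma id_auto [simp]: "(\<lambda>x\<in>carrier Q. x) \<in> auto Q"
  by (auto simp: auto_iff bij_betw_def inj_on_def)

lemma compose_auto [simp]:
  assumes "f \<in> auto Q" "g \<in> auto Q" shows "compose (carrier Q) f g \<in> auto Q"
  using assms bij_betw_compose[of g "carrier Q" "carrier Q" f "carrier Q"]
  by (auto simp: auto_iff compose_eq bij_betw_apply)

lemma inv_into_auto:
  assumes "f \<in> auto Q" shows "(\<lambda>x\<in>carrier Q. inv_into (carrier Q) f x) \<in> auto Q"
proof -
  have f: "f \<in> Bij (carrier Q)" using assms by (simp add: auto_def)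
  have "inv_into (carrier Q) f (x \<otimes> y) = inv_into (carrier Q) f x \<otimes> inv_into (carrier Q) f y"
    if "x \<in> carrier Q" "y \<in> carrier Q" for x y
    using Bij_inv_into_lemma[of "carrier Q" f "mult Q" x y] f that assms by (auto simp: auto_mult)
  then show ?thesis
    using restrict_inv_into_Bij[OF f] Bij_inv_into_mem[OF f]
    by (auto simp: auto_iff Bij_def)
qed

lemma AutoGroup_group: "group (AutoGroup Q)"
proof -
  have sub: "auto Q \<subseteq> Bij (carrier Q)" by (auto simp: auto_def)
  have "subgroup (auto Q) (BijGroup (carrier Q))"
  proof (rule group.subgroupI[OF group_BijGroup])
    show "auto Q \<subseteq> carrier (BijGroup (carrier Q))" using sub by (simp add: BijGroup_def)
    show "auto Q \<noteq> {}" using id_auto by blast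
    show "inv\<^bsub>BijGroup (carrier Q)\<^esub> f \<in> auto Q" if "f \<in> auto Q" for f
      using that sub inv_into_auto inv_BijGroup[of f "carrier Q"] by auto
    show "f \<otimes>\<^bsub>BijGroup (carrier Q)\<^esub> g \<in> auto Q" if "f \<in> auto Q" "g \<in> auto Q" for f g
      using that sub by (simp add: BijGroup_def subset_iff)
  qed
  then show ?thesis
    unfolding AutoGroup_def by (rule subgroup.subgroup_is_group[OF _ group_BijGroup])
qed

lemma AutoGroup_carrier [simp]: "carrier (AutoGroup Q) = auto Q"
  by (simp add: AutoGroup_def)

lemma AutoGroup_mult:
  "\<lbrakk>f \<in> auto Q; g \<in> auto Q\<rbrakk> \<Longrightarrow> f \<otimes>\<^bsub>AutoGroup Q\<^esub> g = compose (carrier Q) f g"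
  by (auto simp: AutoGroup_def BijGroup_def auto_def)

lemma AutoGroup_mult_eq_iff:
  assumes "f \<in> auto Q" "g \<in> auto Q" "f' \<in> auto Q" "g' \<in> auto Q"
  shows "f \<otimes>\<^bsub>AutoGroup Q\<^esub> g = f' \<otimes>\<^bsub>AutoGroup Q\<^esub> g' \<longleftrightarrow> (\<forall>x\<in>carrier Q. f (g x) = f' (g' x))"
proof -
  have "compose (carrier Q) f g = compose (carrier Q) f' g'
      \<longleftrightarrow> (\<forall>x\<in>carrier Q. f (g x) = f' (g' x))"
    by (auto simp: compose_def restrict_def fun_eq_iff)
  then show ?thesis using assms by (simp add: AutoGroup_mult)
qed

lemma centralizer_iff:
  assumes "\<phi> \<in> auto Q"
  shows "\<gamma> \<in> centralizer (AutoGroup Q) \<phi> \<longleftrightarrow>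
    \<gamma> \<in> auto Q \<and> (\<forall>x\<in>carrier Q. \<gamma> (\<phi> x) = \<phi> (\<gamma> x))"
  using assms by (auto simp: centralizer_def AutoGroup_mult_eq_iff)

text \<open>
  The pointwise equation \<open>\<gamma> (\<phi> x) = \<phi>' (\<gamma> x)\<close> replaces conjugation in all later arguments, since it can
  be composed and evaluated without mentioning the inverse of \<open>\<gamma>\<close>.
\<close>

lemma conjugation_eq_iff:
  assumes "\<gamma> \<in> auto Q" "\<phi> \<in> E" "E \<subseteq> auto Q" "\<phi>' \<in> auto Q"
  shows "conjugation (AutoGroup Q) E \<gamma> \<phi> = \<phi>' \<longleftrightarrow> (\<forall>x\<in>carrier Q. \<gamma> (\<phi> x) = \<phi>' (\<gamma> x))"
proof -
  interpret A: group "AutoGroup Q" by (rule AutoGroup_group)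
  have \<phi>: "\<phi> \<in> auto Q" using assms by blast
  have "conjugation (AutoGroup Q) E \<gamma> \<phi> = \<phi>'
      \<longleftrightarrow> \<gamma> \<otimes>\<^bsub>AutoGroup Q\<^esub> \<phi> = \<phi>' \<otimes>\<^bsub>AutoGroup Q\<^esub> \<gamma>"
    using assms \<phi> A.inv_solve_right'[of "\<phi>'" "\<gamma> \<otimes>\<^bsub>AutoGroup Q\<^esub> \<phi>" \<gamma>] A.m_closed[of \<gamma> \<phi>]
    by (auto simp: conjugation_def)
  then show ?thesis using assms \<phi> by (simp add: AutoGroup_mult_eq_iff)
qed

section \<open>Automorphisms inverting modulo the center\<close>

lemma inversion_auto: "inversion Q \<in> auto Q"
proof -
  have "bij_betw (inversion Q) (carrier Q) (carrier Q)"
    by (rule bij_betw_byWitness[where f' = "\<lambda>x. inv x"]) (auto simp: inversion_def)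
  then show ?thesis by (auto simp: auto_iff inversion_def inv_mult)
qed

lemma central_map_iff:
  assumes "\<And>x. x \<in> carrier Q \<Longrightarrow> \<alpha> x \<in> carrier Q"
  shows "central_map Q \<alpha> \<longleftrightarrow> (\<forall>x\<in>carrier Q. \<alpha> x \<otimes> inv x \<in> center Q)"
proof -
  have "center Q #> y = center Q #> x \<longleftrightarrow> y \<otimes> inv x \<in> center Q"
    if xy: "x \<in> carrier Q" "y \<in> carrier Q" for x y
  proof
    assume "center Q #> y = center Q #> x"
    moreover have "y \<in> center Q #> y"
      using xy l_one by (force simp: r_coset_def intro: bexI[of _ \<one>])
    ultimately show "y \<otimes> inv x \<in> center Q"
      using xy by (auto simp: r_coset_def)
  next
    assume z: "y \<otimes> inv x \<in> center Q"
    have y: "w \<otimes> y = (w \<otimes> (y \<otimes> inv x)) \<otimes> x" if "w \<in> center Q" for w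
      using xy that by (simp add: center_assoc)
    have x: "w \<otimes> x = (w \<otimes> inv (y \<otimes> inv x)) \<otimes> y" if "w \<in> center Q" for w
      using xy that z inv_l_cancel[of "y \<otimes> inv x" x] by (simp add: center_assoc)
    show "center Q #> y = center Q #> x"
      unfolding r_coset_def using x y center_mult[OF _ z] center_mult[OF _ center_inv[OF z]]
      by blast
  qed
  then show ?thesis using assms by (auto simp: central_map_def)
qed

lemma central_map_inv_iff:
  assumes "\<phi> \<in> auto Q"
  shows "central_map Q (\<lambda>x. inv (\<phi> x)) \<longleftrightarrow> (\<forall>x\<in>carrier Q. \<phi> x \<otimes> x \<in> center Q)"
proof -
  have "inv (\<phi> x) \<otimes> inv x \<in> center Q \<longleftrightarrow> \<phi> x \<otimes> x \<in> center Q" if "x \<in> carrier Q" for x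
    using that assms center_inv[of "\<phi> x \<otimes> x"] center_inv[of "inv (\<phi> x \<otimes> x)"]
    by (auto simp: inv_mult)
  then show ?thesis using assms by (subst central_map_iff) auto
qed

text \<open>
  If \<open>\<phi>\<close> is \<open>\<alpha>\<close> followed by inversion, then \<open>\<phi> x \<otimes> x\<close> is the inverse of \<open>\<alpha> x \<otimes> inv x\<close>, whose centrality
  for all \<open>x\<close> is that of the map \<open>\<alpha>\<close>.
\<close>

lemma J_central_auto_iff:
  "\<phi> \<in> J_central_auto Q \<longleftrightarrow> \<phi> \<in> auto Q \<and> (\<forall>x\<in>carrier Q. \<phi> x \<otimes> x \<in> center Q)"
proof
  assume "\<phi> \<in> J_central_auto Q"
  then obtain \<alpha> where \<alpha>: "\<alpha> \<in> auto Q" "central_map Q \<alpha>"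
    and \<phi>: "\<phi> = compose (carrier Q) (inversion Q) \<alpha>"
    by (auto simp: J_central_auto_def central_auto_def)
  have "\<phi> x \<otimes> x = inv (\<alpha> x \<otimes> inv x)" if "x \<in> carrier Q" for x
    using that \<alpha> by (simp add: \<phi> compose_eq inversion_def inv_mult)
  then show "\<phi> \<in> auto Q \<and> (\<forall>x\<in>carrier Q. \<phi> x \<otimes> x \<in> center Q)"
    using \<alpha> inversion_auto by (simp add: central_map_iff \<phi>)
next
  assume \<phi>: "\<phi> \<in> auto Q \<and> (\<forall>x\<in>carrier Q. \<phi> x \<otimes> x \<in> center Q)"
  define \<alpha> where "\<alpha> = compose (carrier Q) (inversion Q) \<phi>"
  have \<alpha>: "\<alpha> \<in> auto Q" using \<phi> inversion_auto by (simp add: \<alpha>_def)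
  have "\<alpha> x \<otimes> inv x = inv (\<phi> x \<otimes> x)" if "x \<in> carrier Q" for x
    using that \<phi> by (simp add: \<alpha>_def compose_eq inversion_def inv_mult)
  then have "\<alpha> \<in> central_auto Q"
    using \<phi> \<alpha> by (simp add: central_auto_def central_map_iff)
  moreover have "\<phi> = compose (carrier Q) (inversion Q) \<alpha>"
    using \<phi> \<alpha> inversion_auto by (intro auto_eqI) (auto simp: \<alpha>_def compose_eq inversion_def)
  ultimately show "\<phi> \<in> J_central_auto Q" by (auto simp: J_central_auto_def)
qed

lemma J_central_auto_auto [simp]: "\<phi> \<in> J_central_auto Q \<Longrightarrow> \<phi> \<in> auto Q"
  by (simp add: J_central_auto_iff)

lemma J_central_auto_center:
  "\<lbrakk>\<phi> \<in> J_central_auto Q; x \<in> carrier Q\<rbrakk> \<Longrightarrow> \<phi> x \<otimes> x \<in> center Q"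
  using J_central_auto_iff by blast

lemma J_central_auto_conj:
  assumes \<phi>: "\<phi> \<in> J_central_auto Q" and \<gamma>: "\<gamma> \<in> auto Q" and \<phi>': "\<phi>' \<in> auto Q"
    and eq: "\<forall>x\<in>carrier Q. \<gamma> (\<phi> x) = \<phi>' (\<gamma> x)"
  shows "\<phi>' \<in> J_central_auto Q"
  unfolding J_central_auto_iff
proof (intro conjI ballI \<phi>')
  fix y assume "y \<in> carrier Q"
  then obtain x where x: "x \<in> carrier Q" "\<gamma> x = y" using auto_surj[OF \<gamma>] by blast
  then have "\<phi>' y \<otimes> y = \<gamma> (\<phi> x \<otimes> x)" using eq \<gamma> \<phi> by (auto simp: auto_mult)
  then show "\<phi>' y \<otimes> y \<in> center Q" using \<phi> \<gamma> x by (simp add: J_central_auto_center)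
qed

end

section \<open>The homomorphism onto the image of id minus the sum of the coefficients\<close>

text \<open>
  In additive notation \<open>x - (\<phi> x + \<psi> x)\<close>, the map whose image is \<^const>\<open>diff_image\<close>.
\<close>

definition displacement ::
    "('a, 'b) monoid_scheme \<Rightarrow> ('a \<Rightarrow> 'a) \<Rightarrow> ('a \<Rightarrow> 'a) \<Rightarrow> 'a \<Rightarrow> 'a"
  where "displacement Q \<phi> \<psi> x = x \<otimes>\<^bsub>Q\<^esub> inv\<^bsub>Q\<^esub> (\<phi> x \<otimes>\<^bsub>Q\<^esub> \<psi> x)"

context comm_moufang_loop
begin

lemma displacement_mult:
  assumes "\<phi> \<in> auto Q" "\<psi> \<in> auto Q" "u \<in> carrier Q"
  shows "(\<phi> u \<otimes> \<psi> u) \<otimes> displacement Q \<phi> \<psi> u = u"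
  unfolding displacement_def
  using assms comm[of u "inv (\<phi> u \<otimes> \<psi> u)"] by simp

lemma displacement_eqI:
  assumes "\<phi> \<in> auto Q" "\<psi> \<in> auto Q" "u \<in> carrier Q" "d \<in> carrier Q"
    and "(\<phi> u \<otimes> \<psi> u) \<otimes> d = u"
  shows "displacement Q \<phi> \<psi> u = d"
proof (rule l_cancel)
  show "(\<phi> u \<otimes> \<psi> u) \<otimes> displacement Q \<phi> \<psi> u = (\<phi> u \<otimes> \<psi> u) \<otimes> d"
    using displacement_mult[OF assms(1-3)] assms(5) by (rule trans[OF _ sym])
qed (use assms(1-4) in \<open>auto simp: displacement_def\<close>)

text \<open>
  Write \<open>\<phi> u = p \<otimes> inv u\<close> and \<open>\<psi> u = q \<otimes> inv u\<close> with central \<open>p\<close> and \<open>q\<close>, and let \<open>w\<close> be the cube of \<open>u\<close>,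
  which is central.  Then the displacement is \<open>inv (p \<otimes> q) \<otimes> w\<close>.  In the product below, \<open>p \<otimes> q\<close> cancels,
  the two factors \<open>inv u\<close> collect in front of \<open>a \<otimes> b\<close> by \<open>square_mult\<close>, and \<open>w\<close> absorbs them and leaves \<open>u\<close>.
\<close>

lemma displacement_central:
  assumes "\<phi> \<in> J_central_auto Q" "\<psi> \<in> J_central_auto Q" "u \<in> carrier Q"
  shows "displacement Q \<phi> \<psi> u \<in> center Q"
    and displacement_translate: "\<And>a b. \<lbrakk>a \<in> carrier Q; b \<in> carrier Q\<rbrakk> \<Longrightarrow>
      ((a \<otimes> \<phi> u) \<otimes> (b \<otimes> \<psi> u)) \<otimes> displacement Q \<phi> \<psi> u = (a \<otimes> b) \<otimes> u"
proof -
  define p q w where "p = \<phi> u \<otimes> u" and "q = \<psi> u \<otimes> u" and "w = u \<otimes> (u \<otimes> u)"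
  have pq: "p \<in> center Q" "q \<in> center Q" and w: "w \<in> center Q"
    using assms cube_central by (auto simp: p_def q_def w_def J_central_auto_center)
  have \<phi>: "\<phi> u = p \<otimes> inv u" and \<psi>: "\<psi> u = q \<otimes> inv u"
    using assms by (auto simp: p_def q_def)
  have u: "u \<in> carrier Q" "inv u \<in> carrier Q" using assms by auto
  have prod: "(a \<otimes> \<phi> u) \<otimes> (b \<otimes> \<psi> u) = (p \<otimes> q) \<otimes> (inv (u \<otimes> u) \<otimes> (a \<otimes> b))"
    if "a \<in> carrier Q" "b \<in> carrier Q" for a b
    using that u pq square_mult[of "inv u" a b]
    by (simp add: \<phi> \<psi> center_assoc inv_mult comm[of a "inv u"] comm[of b "inv u"]
        center_lcomm[of p a "inv u"] center_lcomm[of q b "inv u"]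
        center_lcomm[of p "inv u" a] center_lcomm[of q "inv u" b]
        center_lcomm[of q "inv u \<otimes> a" "inv u \<otimes> b"])
  have "\<phi> u \<otimes> \<psi> u = (p \<otimes> q) \<otimes> inv (u \<otimes> u)"
    using prod[of \<one> \<one>] u assms by (simp add: l_one r_one)
  moreover have "((p \<otimes> q) \<otimes> inv (u \<otimes> u)) \<otimes> (inv (p \<otimes> q) \<otimes> w) = u"
  proof -
    have "((p \<otimes> q) \<otimes> inv (u \<otimes> u)) \<otimes> (inv (p \<otimes> q) \<otimes> w) = inv (u \<otimes> u) \<otimes> w"
      using pq u w by (simp add: center_assoc[of "p \<otimes> q"] center_lcomm[of "inv (p \<otimes> q)"])
    also have "\<dots> = u" using u comm[of u "u \<otimes> u"] inv_l_cancel[of "u \<otimes> u" u] by (simp add: w_def)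
    finally show ?thesis .
  qed
  ultimately have d: "displacement Q \<phi> \<psi> u = inv (p \<otimes> q) \<otimes> w"
    using assms pq w by (intro displacement_eqI) auto
  then show "displacement Q \<phi> \<psi> u \<in> center Q" using pq w by simp
  show "((a \<otimes> \<phi> u) \<otimes> (b \<otimes> \<psi> u)) \<otimes> displacement Q \<phi> \<psi> u = (a \<otimes> b) \<otimes> u"
    if ab: "a \<in> carrier Q" "b \<in> carrier Q" for a b
  proof -
    have "((p \<otimes> q) \<otimes> (inv (u \<otimes> u) \<otimes> (a \<otimes> b))) \<otimes> (inv (p \<otimes> q) \<otimes> w)
        = (inv (u \<otimes> u) \<otimes> (a \<otimes> b)) \<otimes> w"
      using pq u w ab by (simp add: center_assoc[of "p \<otimes> q"] center_lcomm[of "inv (p \<otimes> q)"])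
    also have "\<dots> = w \<otimes> (inv (u \<otimes> u) \<otimes> (a \<otimes> b))"
      using u w ab by (simp add: comm)
    also have "\<dots> = (w \<otimes> inv (u \<otimes> u)) \<otimes> (a \<otimes> b)"
      using u w ab by (simp add: center_assoc)
    also have "\<dots> = u \<otimes> (a \<otimes> b)" using u by (simp add: w_def)
    also have "\<dots> = (a \<otimes> b) \<otimes> u" using u ab by (simp add: comm)
    finally show ?thesis by (simp only: d prod[OF ab])
  qed
qed

text \<open>
  The displacement of \<open>u\<close> is the only \<open>d\<close> with \<open>(\<phi> u \<otimes> \<psi> u) \<otimes> d = u\<close>.  That the product of the
  displacements of \<open>u\<close> and \<open>v\<close> has this property at \<open>u \<otimes> v\<close> follows from \<open>displacement_translate\<close> by
  \<open>v\<close> at \<open>a = \<phi> u\<close> and \<open>b = \<psi> u\<close>.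
\<close>

lemma displacement_hom:
  assumes \<phi>\<psi>: "\<phi> \<in> J_central_auto Q" "\<psi> \<in> J_central_auto Q"
    and uv: "u \<in> carrier Q" "v \<in> carrier Q"
  shows "displacement Q \<phi> \<psi> (u \<otimes> v) = displacement Q \<phi> \<psi> u \<otimes> displacement Q \<phi> \<psi> v"
proof -
  let ?d = "displacement Q \<phi> \<psi>"
  have d: "?d u \<in> center Q" "?d v \<in> center Q"
    using displacement_central(1) assms by auto
  have "(\<phi> (u \<otimes> v) \<otimes> \<psi> (u \<otimes> v)) \<otimes> (?d u \<otimes> ?d v)
      = ?d u \<otimes> (((\<phi> u \<otimes> \<phi> v) \<otimes> (\<psi> u \<otimes> \<psi> v)) \<otimes> ?d v)"
    using assms d by (simp add: auto_mult center_lcomm)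
  also have "\<dots> = ?d u \<otimes> ((\<phi> u \<otimes> \<psi> u) \<otimes> v)"
    using displacement_translate[OF \<phi>\<psi> uv(2), of "\<phi> u" "\<psi> u"] assms by simp
  also have "\<dots> = ((\<phi> u \<otimes> \<psi> u) \<otimes> ?d u) \<otimes> v"
    using d uv \<phi>\<psi> by (simp add: center_assoc comm[of "\<phi> u \<otimes> \<psi> u" "?d u"])
  also have "\<dots> = u \<otimes> v" using displacement_mult assms by simp
  finally show ?thesis using assms d by (intro displacement_eqI) auto
qed

lemma displacement_auto:
  assumes "\<gamma> \<in> auto Q" "u \<in> carrier Q"
    and "\<phi> \<in> auto Q" "\<psi> \<in> auto Q" "\<phi>' \<in> auto Q" "\<psi>' \<in> auto Q"
    and "\<forall>x\<in>carrier Q. \<gamma> (\<phi> x) = \<phi>' (\<gamma> x)" "\<forall>x\<in>carrier Q. \<gamma> (\<psi> x) = \<psi>' (\<gamma> x)"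
  shows "\<gamma> (displacement Q \<phi> \<psi> u) = displacement Q \<phi>' \<psi>' (\<gamma> u)"
  using assms by (simp add: displacement_def auto_mult auto_inv)

lemma diff_image_displacement: "diff_image Q \<phi> \<psi> = displacement Q \<phi> \<psi> ` carrier Q"
  by (simp add: diff_image_def displacement_def)

lemma diff_image_subgroup:
  assumes \<phi>\<psi>: "\<phi> \<in> J_central_auto Q" "\<psi> \<in> J_central_auto Q"
  shows "subgroup (diff_image Q \<phi> \<psi>) (Q\<lparr>carrier := center Q\<rparr>)"
proof -
  let ?d = "displacement Q \<phi> \<psi>" and ?Z = "Q\<lparr>carrier := center Q\<rparr>"
  interpret Z: comm_group ?Z by (rule center_comm_group)
  have d1: "?d \<one> = \<one>" using \<phi>\<psi> by (simp add: displacement_def l_one)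
  show ?thesis
  proof (rule Z.subgroupI)
    show "diff_image Q \<phi> \<psi> \<subseteq> carrier ?Z"
      using displacement_central(1)[OF \<phi>\<psi>] by (auto simp: diff_image_displacement)
    show "diff_image Q \<phi> \<psi> \<noteq> {}" by (auto simp: diff_image_displacement)
    fix a assume "a \<in> diff_image Q \<phi> \<psi>"
    then obtain u where u: "u \<in> carrier Q" "a = ?d u" by (auto simp: diff_image_displacement)
    have "?d (inv u) \<otimes> ?d u = \<one>"
      using displacement_hom[OF \<phi>\<psi>, of "inv u" u] u d1 by simp
    then have "inv\<^bsub>?Z\<^esub> a = ?d (inv u)"
      using u displacement_central(1)[OF \<phi>\<psi>] by (intro Z.inv_equality) auto
    then show "inv\<^bsub>?Z\<^esub> a \<in> diff_image Q \<phi> \<psi>"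
      using u by (auto simp: diff_image_displacement)
    fix b assume "b \<in> diff_image Q \<phi> \<psi>"
    then obtain v where v: "v \<in> carrier Q" "b = ?d v" by (auto simp: diff_image_displacement)
    show "a \<otimes>\<^bsub>?Z\<^esub> b \<in> diff_image Q \<phi> \<psi>"
      using u v displacement_hom[OF \<phi>\<psi>, of u v]
      by (auto simp: diff_image_displacement intro!: image_eqI[of _ _ "u \<otimes> v"])
  qed
qed

section \<open>Isomorphisms between affine quasigroups\<close>

lemma affine_op_eq [simp]:
  "\<lbrakk>x \<in> carrier Q; y \<in> carrier Q\<rbrakk> \<Longrightarrow> affine_op Q \<phi> \<psi> c x y = (\<phi> x \<otimes> \<psi> y) \<otimes> c"
  by (simp add: affine_op_def)

lemma affine_op_quasigroup:
  assumes \<phi>: "\<phi> \<in> auto Q" and \<psi>: "\<psi> \<in> auto Q" and c: "c \<in> carrier Q"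
  shows "quasigroup (carrier Q) (affine_op Q \<phi> \<psi> c)"
proof
  have \<phi>b: "bij_betw \<phi> (carrier Q) (carrier Q)" and \<psi>b: "bij_betw \<psi> (carrier Q) (carrier Q)"
    using \<phi> \<psi> by (auto simp: auto_iff)
  note R = right_translation_bij[OF c]
  fix x assume x: "x \<in> carrier Q"
  have "bij_betw ((\<lambda>y. y \<otimes> c) \<circ> ((\<lambda>y. \<phi> x \<otimes> y) \<circ> \<psi>)) (carrier Q) (carrier Q)"
    using bij_betw_trans[OF bij_betw_trans[OF \<psi>b left_translation_bij] R] \<phi> x by simp
  then show "bij_betw (\<lambda>y. affine_op Q \<phi> \<psi> c x y) (carrier Q) (carrier Q)"
    using x by (subst bij_betw_cong) (auto)
  have "bij_betw ((\<lambda>y. y \<otimes> c) \<circ> ((\<lambda>y. y \<otimes> \<psi> x) \<circ> \<phi>)) (carrier Q) (carrier Q)"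
    using bij_betw_trans[OF bij_betw_trans[OF \<phi>b right_translation_bij] R] \<psi> x by simp
  then show "bij_betw (\<lambda>y. affine_op Q \<phi> \<psi> c y x) (carrier Q) (carrier Q)"
    using x by (subst bij_betw_cong) (auto)
qed

text \<open>
  Automorphisms transport the coefficients, and \<open>displacement_translate\<close> shows that a translation
  changes only the constant.
\<close>

lemma affine_op_isomorphism:
  assumes \<phi>\<psi>: "\<phi> \<in> auto Q" "\<psi> \<in> auto Q" "\<phi>' \<in> J_central_auto Q" "\<psi>' \<in> J_central_auto Q"
    and \<gamma>: "\<gamma> \<in> auto Q" "\<forall>x\<in>carrier Q. \<gamma> (\<phi> x) = \<phi>' (\<gamma> x)" "\<forall>x\<in>carrier Q. \<gamma> (\<psi> x) = \<psi>' (\<gamma> x)"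
    and c: "c \<in> center Q" and u: "u \<in> carrier Q"
  defines "h \<equiv> \<lambda>x. \<gamma> x \<otimes> u" and "c' \<equiv> displacement Q \<phi>' \<psi>' u \<otimes> \<gamma> c"
  shows "bij_betw h (carrier Q) (carrier Q)"
    and "\<And>x y. \<lbrakk>x \<in> carrier Q; y \<in> carrier Q\<rbrakk> \<Longrightarrow>
      h (affine_op Q \<phi> \<psi> c x y) = affine_op Q \<phi>' \<psi>' c' (h x) (h y)"
proof -
  have "bij_betw ((\<lambda>y. y \<otimes> u) \<circ> \<gamma>) (carrier Q) (carrier Q)"
    using bij_betw_trans[OF _ right_translation_bij[OF u]] \<gamma>(1) by (auto simp: auto_iff)
  then show "bij_betw h (carrier Q) (carrier Q)" by (simp add: h_def comp_def)
  fix x y assume xy: "x \<in> carrier Q" "y \<in> carrier Q"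
  define a b d where "a = \<phi>' (\<gamma> x)" and "b = \<psi>' (\<gamma> y)" and "d = displacement Q \<phi>' \<psi>' u"
  have ab: "a \<in> carrier Q" "b \<in> carrier Q" using \<phi>\<psi> \<gamma> xy by (auto simp: a_def b_def)
  have d: "d \<in> center Q" using displacement_central(1)[OF \<phi>\<psi>(3,4) u] by (simp add: d_def)
  have u': "\<phi>' u \<in> carrier Q" "\<psi>' u \<in> carrier Q" using \<phi>\<psi> u by auto
  have gc: "\<gamma> c \<in> center Q" using \<gamma> c by simp
  have "h (affine_op Q \<phi> \<psi> c x y) = ((a \<otimes> b) \<otimes> \<gamma> c) \<otimes> u"
    using xy \<phi>\<psi> \<gamma> c by (simp add: h_def auto_mult a_def b_def)
  also have "\<dots> = ((a \<otimes> b) \<otimes> u) \<otimes> \<gamma> c"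
    using ab u gc center_rassoc[OF gc, of "a \<otimes> b" u] center_assoc[OF gc, of "a \<otimes> b" u]
      comm[of "a \<otimes> b" "\<gamma> c"] comm[of "(a \<otimes> b) \<otimes> u" "\<gamma> c"] by simp
  also have "(a \<otimes> b) \<otimes> u = ((a \<otimes> \<phi>' u) \<otimes> (b \<otimes> \<psi>' u)) \<otimes> d"
    using displacement_translate[OF \<phi>\<psi>(3,4) u ab] by (simp add: d_def)
  also have "\<dots> \<otimes> \<gamma> c = ((a \<otimes> \<phi>' u) \<otimes> (b \<otimes> \<psi>' u)) \<otimes> (d \<otimes> \<gamma> c)"
    using ab u' d gc by (simp add: center_rassoc)
  also have "\<dots> = affine_op Q \<phi>' \<psi>' c' (h x) (h y)"
    using xy \<phi>\<psi> \<gamma> u by (simp add: h_def auto_mult a_def b_def c'_def d_def)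
  finally show "h (affine_op Q \<phi> \<psi> c x y) = affine_op Q \<phi>' \<psi>' c' (h x) (h y)" .
qed

text \<open>
  Evaluating the isomorphism at the neutral element gives \<open>h c = c'\<close>.  The map
  \<open>\<theta> x = h (x \<otimes> c) \<otimes> inv c'\<close> is then multiplicative because \<open>c'\<close> is central, and \<open>\<phi>' \<circ> h = \<theta> \<circ> \<phi>\<close>.
  As \<open>\<phi>'\<close> is an injective homomorphism, \<open>h\<close> is multiplicative as well.
\<close>

lemma unital_isomorphism_auto:
  assumes \<phi>\<psi>: "\<phi> \<in> auto Q" "\<psi> \<in> auto Q" "\<phi>' \<in> auto Q" "\<psi>' \<in> auto Q"
    and c: "c \<in> carrier Q" and c': "c' \<in> center Q"
    and h: "h \<in> extensional (carrier Q)" "bij_betw h (carrier Q) (carrier Q)" "h \<one> = \<one>"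
    and iso: "\<And>x y. \<lbrakk>x \<in> carrier Q; y \<in> carrier Q\<rbrakk> \<Longrightarrow>
      h (affine_op Q \<phi> \<psi> c x y) = affine_op Q \<phi>' \<psi>' c' (h x) (h y)"
  shows "h \<in> auto Q" "\<forall>x\<in>carrier Q. h (\<phi> x) = \<phi>' (h x)" "\<forall>x\<in>carrier Q. h (\<psi> x) = \<psi>' (h x)"
    "h c = c'"
proof -
  have hc [simp]: "h x \<in> carrier Q" if "x \<in> carrier Q" for x
    using h that by (auto simp: bij_betw_def)
  have iso: "h ((\<phi> x \<otimes> \<psi> y) \<otimes> c) = (\<phi>' (h x) \<otimes> \<psi>' (h y)) \<otimes> c'"
    if "x \<in> carrier Q" "y \<in> carrier Q" for x y
    using iso[of x y] that by simp
  show cc': "h c = c'"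
    using iso[of \<one> \<one>] \<phi>\<psi> c c' h(3) by (simp add: l_one)
  have l: "h (\<phi> x \<otimes> c) = \<phi>' (h x) \<otimes> c'" if "x \<in> carrier Q" for x
    using iso[of x \<one>] that \<phi>\<psi> h(3) by (simp add: r_one)
  have r: "h (\<psi> x \<otimes> c) = \<psi>' (h x) \<otimes> c'" if "x \<in> carrier Q" for x
    using iso[of \<one> x] that \<phi>\<psi> h(3) by (simp add: l_one)
  define \<theta> where "\<theta> x = h (x \<otimes> c) \<otimes> inv c'" for x
  have \<theta>\<phi>: "\<theta> (\<phi> x) = \<phi>' (h x)" and \<theta>\<psi>: "\<theta> (\<psi> x) = \<psi>' (h x)" if "x \<in> carrier Q" for x
    using that l r \<phi>\<psi> c' by (simp_all add: \<theta>_def)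
  have \<theta>_mult: "\<theta> (a \<otimes> b) = \<theta> a \<otimes> \<theta> b" if ab: "a \<in> carrier Q" "b \<in> carrier Q" for a b
  proof -
    obtain x y where "x \<in> carrier Q" "a = \<phi> x" "y \<in> carrier Q" "b = \<psi> y"
      using ab auto_surj \<phi>\<psi> by metis
    then show ?thesis
      using iso[of x y] \<theta>\<phi> \<theta>\<psi> \<phi>\<psi> c' by (simp add: \<theta>_def)
  qed
  have "h (x \<otimes> y) = h x \<otimes> h y" if "x \<in> carrier Q" "y \<in> carrier Q" for x y
  proof (rule auto_inj[of \<phi>'])
    show "\<phi>' (h (x \<otimes> y)) = \<phi>' (h x \<otimes> h y)"
      using that \<phi>\<psi> \<theta>_mult[of "\<phi> x" "\<phi> y"] by (simp add: \<theta>\<phi>[symmetric] auto_mult)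
  qed (use that \<phi>\<psi> in auto)
  then show h_auto: "h \<in> auto Q" using h by (simp add: auto_iff)
  have cancel: "a = b" if "a \<otimes> c' = b \<otimes> c'" "a \<in> carrier Q" "b \<in> carrier Q" for a b
  proof (rule l_cancel)
    show "c' \<otimes> a = c' \<otimes> b" using comm[of c' a] comm[of c' b] that c' by simp
  qed (use that c' in auto)
  have hc': "h (x \<otimes> c) = h x \<otimes> c'" if "x \<in> carrier Q" for x
    using auto_mult[OF h_auto that c] cc' by simp
  show "\<forall>x\<in>carrier Q. h (\<phi> x) = \<phi>' (h x)"
  proof
    fix x assume x: "x \<in> carrier Q"
    show "h (\<phi> x) = \<phi>' (h x)"
      by (rule cancel) (use x l[OF x] hc'[of "\<phi> x"] \<phi>\<psi> in auto)
  qed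
  show "\<forall>x\<in>carrier Q. h (\<psi> x) = \<psi>' (h x)"
  proof
    fix x assume x: "x \<in> carrier Q"
    show "h (\<psi> x) = \<psi>' (h x)"
      by (rule cancel) (use x r[OF x] hc'[of "\<psi> x"] \<phi>\<psi> in auto)
  qed
qed

text \<open>
  An isomorphism \<open>h\<close> followed by the translation by the inverse of \<open>h \<one>\<close> fixes \<open>\<one>\<close>, so it is an
  automorphism; the translation accounts for the element of the image of the displacement by which
  \<open>c'\<close> and \<open>\<gamma> c\<close> differ.
\<close>

proposition affine_op_isomorphic_iff:
  assumes \<phi>\<psi>: "\<phi> \<in> auto Q" "\<psi> \<in> auto Q" "\<phi>' \<in> J_central_auto Q" "\<psi>' \<in> J_central_auto Q"
    and c: "c \<in> center Q" "c' \<in> center Q"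
  shows "quasigroup_isomorphic (carrier Q) (affine_op Q \<phi> \<psi> c) (affine_op Q \<phi>' \<psi>' c') \<longleftrightarrow>
    (\<exists>\<gamma>\<in>auto Q. (\<forall>x\<in>carrier Q. \<gamma> (\<phi> x) = \<phi>' (\<gamma> x)) \<and> (\<forall>x\<in>carrier Q. \<gamma> (\<psi> x) = \<psi>' (\<gamma> x)) \<and>
      c' \<in> diff_image Q \<phi>' \<psi>' #> \<gamma> c)"
    (is "?iso \<longleftrightarrow> ?conj")
proof
  assume ?conj
  then obtain \<gamma> u where \<gamma>: "\<gamma> \<in> auto Q" "\<forall>x\<in>carrier Q. \<gamma> (\<phi> x) = \<phi>' (\<gamma> x)"
      "\<forall>x\<in>carrier Q. \<gamma> (\<psi> x) = \<psi>' (\<gamma> x)" and u: "u \<in> carrier Q"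
      and c'_eq: "c' = displacement Q \<phi>' \<psi>' u \<otimes> \<gamma> c"
    by (auto simp: r_coset_def diff_image_displacement)
  show ?iso
    unfolding quasigroup_isomorphic_def c'_eq
    using affine_op_isomorphism[OF \<phi>\<psi> \<gamma> c(1) u] by blast
next
  assume ?iso
  then obtain h where h: "bij_betw h (carrier Q) (carrier Q)"
    and iso: "\<And>x y. \<lbrakk>x \<in> carrier Q; y \<in> carrier Q\<rbrakk> \<Longrightarrow>
      h (affine_op Q \<phi> \<psi> c x y) = affine_op Q \<phi>' \<psi>' c' (h x) (h y)"
    unfolding quasigroup_isomorphic_def by blast
  have hc [simp]: "h x \<in> carrier Q" if "x \<in> carrier Q" for x
    using h that by (auto simp: bij_betw_def)
  let ?d = "displacement Q \<phi>' \<psi>'" and ?id = "\<lambda>x\<in>carrier Q. x"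
  define u where "u = h \<one>"
  have u: "u \<in> carrier Q" by (simp add: u_def)
  have iu: "inv u \<in> carrier Q" using u by simp
  have id_comm: "\<forall>x\<in>carrier Q. ?id (\<phi>' x) = \<phi>' (?id x)" "\<forall>x\<in>carrier Q. ?id (\<psi>' x) = \<psi>' (?id x)"
    using \<phi>\<psi> by auto
  \<comment> \<open>The correcting translation, as the case of \<open>affine_op_isomorphism\<close> with trivial automorphism.\<close>
  note t = affine_op_isomorphism[OF J_central_auto_auto[OF \<phi>\<psi>(3)] J_central_auto_auto[OF \<phi>\<psi>(4)]
      \<phi>\<psi>(3,4) id_auto id_comm c(2) iu]
  have opc: "affine_op Q \<phi> \<psi> c x y \<in> carrier Q" "affine_op Q \<phi>' \<psi>' c' x y \<in> carrier Q"
    if "x \<in> carrier Q" "y \<in> carrier Q" for x y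
    using that \<phi>\<psi> c by auto
  define \<gamma> where "\<gamma> = (\<lambda>x\<in>carrier Q. h x \<otimes> inv u)"
  have \<gamma>_bij: "bij_betw \<gamma> (carrier Q) (carrier Q)"
    using bij_betw_trans[OF h right_translation_bij[OF iu]]
    by (subst bij_betw_cong[of _ _ "(\<lambda>y. y \<otimes> inv u) \<circ> h"]) (auto simp: \<gamma>_def)
  define c'' where "c'' = ?d (inv u) \<otimes> c'"
  have dc: "?d (inv u) \<in> center Q" "?d u \<in> center Q"
    using displacement_central(1)[OF \<phi>\<psi>(3,4)] u by auto
  have c'': "c'' \<in> center Q" using dc c by (simp add: c''_def)
  have \<gamma>_iso: "\<gamma> (affine_op Q \<phi> \<psi> c x y) = affine_op Q \<phi>' \<psi>' c'' (\<gamma> x) (\<gamma> y)"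
    if "x \<in> carrier Q" "y \<in> carrier Q" for x y
    using t(2)[of "h x" "h y"] that opc iso c
    by (simp del: affine_op_eq add: \<gamma>_def c''_def)
  have \<gamma>1: "\<gamma> \<one> = \<one>" and \<gamma>e: "\<gamma> \<in> extensional (carrier Q)" using u by (auto simp: \<gamma>_def u_def)
  note \<gamma> = unital_isomorphism_auto[OF \<phi>\<psi>(1,2) J_central_auto_auto[OF \<phi>\<psi>(3)]
      J_central_auto_auto[OF \<phi>\<psi>(4)] center_carrier[OF c(1)] c'' \<gamma>e \<gamma>_bij \<gamma>1 \<gamma>_iso]
  have "?d u \<otimes> ?d (inv u) = \<one>"
    using displacement_hom[OF \<phi>\<psi>(3,4) u iu] u \<phi>\<psi> by (simp add: displacement_def l_one)
  then have "c' = ?d u \<otimes> c''"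
    using dc c by (simp add: c''_def center_assoc[symmetric] l_one)
  then have "c' \<in> diff_image Q \<phi>' \<psi>' #> \<gamma> c"
    using \<gamma>(4) u by (auto simp: r_coset_def diff_image_displacement)
  then show ?conj using \<gamma> by blast
qed

section \<open>The action on cosets of the center\<close>

lemma center_quotient_iff:
  "C \<in> center_quotient Q I \<longleftrightarrow> (\<exists>c\<in>center Q. C = I #> c)"
  by (auto simp: center_quotient_def FactGroup_def RCOSETS_def r_coset_def)

lemma diff_image_coset:
  assumes \<phi>\<psi>: "\<phi> \<in> J_central_auto Q" "\<psi> \<in> J_central_auto Q" and c: "c \<in> center Q"
  shows diff_image_coset_self: "c \<in> diff_image Q \<phi> \<psi> #> c"
    and diff_image_coset_center: "\<And>c'. c' \<in> diff_image Q \<phi> \<psi> #> c \<Longrightarrow> c' \<in> center Q"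
    and diff_image_coset_eq: "\<And>c'. c' \<in> diff_image Q \<phi> \<psi> #> c \<Longrightarrow>
      diff_image Q \<phi> \<psi> #> c' = diff_image Q \<phi> \<psi> #> c"
proof -
  let ?Z = "Q\<lparr>carrier := center Q\<rparr>"
  interpret Z: comm_group ?Z by (rule center_comm_group)
  have coset: "I #>\<^bsub>?Z\<^esub> a = I #> a" for I a by (simp add: r_coset_def)
  have sub: "subgroup (diff_image Q \<phi> \<psi>) ?Z" using \<phi>\<psi> by (rule diff_image_subgroup)
  have c: "c \<in> carrier ?Z" using c by simp
  show "c \<in> diff_image Q \<phi> \<psi> #> c"
    using Z.rcos_self[OF c sub] by (simp only: coset)
  show "c' \<in> center Q" if "c' \<in> diff_image Q \<phi> \<psi> #> c" for c'
    using Z.r_coset_subset_G[OF subgroup.subset[OF sub] c] that by (auto simp: coset)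
  show "diff_image Q \<phi> \<psi> #> c' = diff_image Q \<phi> \<psi> #> c" if "c' \<in> diff_image Q \<phi> \<psi> #> c" for c'
    using Z.repr_independence[OF _ c sub, of c'] that by (simp only: coset)
qed

text \<open>
  An automorphism commuting with both coefficients commutes with the displacement, so it maps the
  image of the displacement to itself and the union defining the action is one coset.
\<close>

lemma quotient_action_coset:
  assumes \<phi>\<psi>: "\<phi> \<in> J_central_auto Q" "\<psi> \<in> J_central_auto Q" and c: "c \<in> center Q"
    and \<gamma>: "\<gamma> \<in> auto Q" "\<forall>x\<in>carrier Q. \<gamma> (\<phi> x) = \<phi> (\<gamma> x)" "\<forall>x\<in>carrier Q. \<gamma> (\<psi> x) = \<psi> (\<gamma> x)"
  shows "quotient_action Q (diff_image Q \<phi> \<psi>) \<gamma> (diff_image Q \<phi> \<psi> #> c) =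
    diff_image Q \<phi> \<psi> #> \<gamma> c"
proof -
  let ?I = "diff_image Q \<phi> \<psi>" and ?d = "displacement Q \<phi> \<psi>"
  have "?I #> \<gamma> u = ?I #> \<gamma> c" if u: "u \<in> ?I #> c" for u
  proof (rule diff_image_coset_eq[OF \<phi>\<psi> auto_center[OF \<gamma>(1) c]])
    obtain v where v: "v \<in> carrier Q" "u = ?d v \<otimes> c"
      using u by (auto simp: r_coset_def diff_image_displacement)
    have "\<gamma> (?d v) = ?d (\<gamma> v)"
      using displacement_auto[OF \<gamma>(1) v(1) _ _ _ _ \<gamma>(2,3)] J_central_auto_auto \<phi>\<psi> by blast
    moreover have "\<gamma> (?d v \<otimes> c) = \<gamma> (?d v) \<otimes> \<gamma> c"
      using auto_mult[OF \<gamma>(1)] displacement_central(1)[OF \<phi>\<psi> v(1)] center_carrier c by blast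
    ultimately have "\<gamma> u = ?d (\<gamma> v) \<otimes> \<gamma> c"
      by (simp only: v(2))
    moreover have "\<gamma> v \<in> carrier Q" using \<gamma>(1) v(1) by simp
    ultimately show "\<gamma> u \<in> ?I #> \<gamma> c"
      unfolding r_coset_def diff_image_displacement by blast
  qed
  then have "(\<Union>u\<in>?I #> c. ?I #> \<gamma> u) = ?I #> \<gamma> c"
    using diff_image_coset_self[OF \<phi>\<psi> c] by blast
  moreover have "?I #> c \<in> center_quotient Q ?I" using c center_quotient_iff by blast
  ultimately show ?thesis
    by (simp only: quotient_action_def restrict_apply if_True)
qed

lemma conjugate_exists:
  assumes "\<gamma> \<in> auto Q" "\<psi> \<in> auto Q"
  obtains \<psi>' where "\<psi>' \<in> auto Q" "\<forall>x\<in>carrier Q. \<gamma> (\<psi> x) = \<psi>' (\<gamma> x)"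
proof -
  interpret A: group "AutoGroup Q" by (rule AutoGroup_group)
  let ?\<psi>' = "conjugation (AutoGroup Q) (auto Q) \<gamma> \<psi>"
  have "?\<psi>' \<in> auto Q"
    using assms A.m_closed[of "\<gamma> \<otimes>\<^bsub>AutoGroup Q\<^esub> \<psi>" "inv\<^bsub>AutoGroup Q\<^esub> \<gamma>"]
      A.m_closed[of \<gamma> \<psi>] A.inv_closed[of \<gamma>] by (simp add: conjugation_def)
  then show thesis
    using that conjugation_eq_iff[OF assms subset_refl, of ?\<psi>'] by blast
qed

end

section \<open>Orbit representatives and isomorphism classes\<close>

lemma orbit_representatives_hit:
  assumes "orbit_representatives G E act R" "x \<in> E"
  obtains g where "g \<in> carrier G" "act g x \<in> R"
proof -
  have "orbit G act x \<in> orbits G E act" using assms(2) by (auto simp: orbits_def)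
  then have "\<exists>r. r \<in> R \<and> r \<in> orbit G act x"
    using assms(1) unfolding orbit_representatives_def by blast
  then show thesis using that by (auto simp: orbit_def)
qed

text \<open>
  An element \<open>e\<close> fixing \<open>r\<close> stands in for the neutral element; it is what puts \<open>r\<close> into its own orbit.
\<close>

lemma orbit_representatives_unique:
  assumes R: "orbit_representatives G E act R" and "r \<in> R" "s \<in> R"
    and "g \<in> carrier G" "act g r = s" and "e \<in> carrier G" "act e r = r"
  shows "r = s"
proof -
  have "orbit G act r \<in> orbits G E act"
    using R \<open>r \<in> R\<close> by (auto simp: orbits_def orbit_representatives_def)
  then have "\<exists>!t. t \<in> R \<and> t \<in> orbit G act r"
    using R unfolding orbit_representatives_def by blast
  moreover have "act e r \<in> orbit G act r" "act g r \<in> orbit G act r"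
    using assms(4,6) by (auto simp: orbit_def)
  ultimately show ?thesis using assms(2,3,5,7) by auto
qed

text \<open>
  Closure of \<open>f\<close> is needed because the inverse of the bijection is controlled only on \<open>S\<close>.
\<close>

lemma quasigroup_isomorphic_sym:
  assumes iso: "quasigroup_isomorphic S f g"
    and f: "\<And>x y. \<lbrakk>x \<in> S; y \<in> S\<rbrakk> \<Longrightarrow> f x y \<in> S"
  shows "quasigroup_isomorphic S g f"
proof -
  obtain h where h: "bij_betw h S S" "\<And>x y. \<lbrakk>x \<in> S; y \<in> S\<rbrakk> \<Longrightarrow> h (f x y) = g (h x) (h y)"
    using iso unfolding quasigroup_isomorphic_def by blast
  let ?k = "inv_into S h"
  have k: "bij_betw ?k S S" using h(1) by (rule bij_betw_inv_into)
  have "?k (g x y) = f (?k x) (?k y)" if "x \<in> S" "y \<in> S" for x y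
  proof -
    have "?k x \<in> S" "?k y \<in> S" using k that by (auto simp: bij_betw_def)
    moreover have "h (?k x) = x" "h (?k y) = y"
      using bij_betw_inv_into_right[OF h(1)] that by auto
    ultimately have "g x y = h (f (?k x) (?k y))" using h(2) by simp
    then show ?thesis
      using bij_betw_inv_into_left[OF h(1)] f \<open>?k x \<in> S\<close> \<open>?k y \<in> S\<close> by simp
  qed
  then show ?thesis unfolding quasigroup_isomorphic_def using k by blast
qed

lemma quasigroup_isomorphic_trans:
  assumes "quasigroup_isomorphic S f g" "quasigroup_isomorphic S g k"
  shows "quasigroup_isomorphic S f k"
proof -
  obtain h h' where h: "bij_betw h S S" "\<forall>x\<in>S. \<forall>y\<in>S. h (f x y) = g (h x) (h y)"
    and h': "bij_betw h' S S" "\<forall>x\<in>S. \<forall>y\<in>S. h' (g x y) = k (h' x) (h' y)"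
    using assms unfolding quasigroup_isomorphic_def by blast
  have "bij_betw (h' \<circ> h) S S" using h(1) h'(1) by (rule bij_betw_trans)
  moreover have "\<forall>x\<in>S. \<forall>y\<in>S. (h' \<circ> h) (f x y) = k ((h' \<circ> h) x) ((h' \<circ> h) y)"
    using h h' by (simp add: bij_betw_apply)
  ultimately show ?thesis unfolding quasigroup_isomorphic_def by blast
qed

lemma equiv_quasigroup_isomorphic:
  assumes "\<And>f x y. \<lbrakk>f \<in> \<K>; x \<in> S; y \<in> S\<rbrakk> \<Longrightarrow> f x y \<in> S"
  shows "equiv \<K> {(f, g). f \<in> \<K> \<and> g \<in> \<K> \<and> quasigroup_isomorphic S f g}"
proof (rule equivI)
  have "quasigroup_isomorphic S f f" for f
    unfolding quasigroup_isomorphic_def by (rule exI[of _ id]) simp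
  then show "refl_on \<K> {(f, g). f \<in> \<K> \<and> g \<in> \<K> \<and> quasigroup_isomorphic S f g}"
    by (auto simp: refl_on_def)
  show "sym {(f, g). f \<in> \<K> \<and> g \<in> \<K> \<and> quasigroup_isomorphic S f g}"
    using assms by (auto intro!: symI quasigroup_isomorphic_sym)
  show "trans {(f, g). f \<in> \<K> \<and> g \<in> \<K> \<and> quasigroup_isomorphic S f g}"
    by (auto intro!: transI intro: quasigroup_isomorphic_trans)
qed auto

context comm_moufang_loop
begin

section \<open>Classification by successive normalization\<close>

text \<open>
  The set \<open>E \<phi>\<close> consists of the second coefficients admitted with the first coefficient \<open>\<phi>\<close>; all that
  matters is that the family \<open>E\<close> is carried along by conjugation.

  The class attached to \<open>(\<phi>, \<psi>, C)\<close> does not depend on the constant chosen in \<open>C\<close>, as constants of one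
  coset differ by a displacement.  For injectivity, an isomorphism yields \<open>\<gamma>\<close> conjugating the
  coefficients.  Uniqueness of representatives in \<open>X\<close> forces the first coefficients to agree, so \<open>\<gamma>\<close>
  centralizes \<open>\<phi>\<close>; then uniqueness in \<open>Y \<phi>\<close> forces the second coefficients to agree, so \<open>\<gamma>\<close> centralizes
  both, and uniqueness in \<open>Z \<phi> \<psi>\<close> identifies the cosets.  For surjectivity, three automorphisms
  normalize the first coefficient, the second coefficient and the coset in turn, each centralizing what
  has been normalized before, and their composite is the required isomorphism.
\<close>

lemma affine_quasigroups_classified:
  fixes E :: "('a \<Rightarrow> 'a) \<Rightarrow> ('a \<Rightarrow> 'a) set"
  defines "J \<equiv> J_central_auto Q" and "A \<equiv> AutoGroup Q"
  assumes E: "\<And>\<phi>. \<phi> \<in> J \<Longrightarrow> E \<phi> \<subseteq> J"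
    and E_conj: "\<And>\<phi> \<psi> \<phi>' \<psi>' \<gamma>. \<lbrakk>\<phi> \<in> J; \<psi> \<in> E \<phi>; \<phi>' \<in> J; \<psi>' \<in> auto Q; \<gamma> \<in> auto Q;
      \<forall>x\<in>carrier Q. \<gamma> (\<phi> x) = \<phi>' (\<gamma> x); \<forall>x\<in>carrier Q. \<gamma> (\<psi> x) = \<psi>' (\<gamma> x)\<rbrakk> \<Longrightarrow> \<psi>' \<in> E \<phi>'"
    and \<K>: "\<K> = {affine_op Q \<phi> \<psi> c |\<phi> \<psi> c. \<phi> \<in> J \<and> \<psi> \<in> E \<phi> \<and> c \<in> center Q}"
    and X: "orbit_representatives A J (conjugation A J) X"
    and Y: "\<forall>\<phi>\<in>X. orbit_representatives (A\<lparr>carrier := centralizer A \<phi>\<rparr>)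
      (E \<phi>) (conjugation A (E \<phi>)) (Y \<phi>)"
    and Z: "\<forall>\<phi>\<in>X. \<forall>\<psi>\<in>Y \<phi>. orbit_representatives (A\<lparr>carrier := centralizer A \<phi> \<inter> centralizer A \<psi>\<rparr>)
      (center_quotient Q (diff_image Q \<phi> \<psi>)) (quotient_action Q (diff_image Q \<phi> \<psi>)) (Z \<phi> \<psi>)"
  shows "classifies Q {(\<phi>, \<psi>, C). \<phi> \<in> X \<and> \<psi> \<in> Y \<phi> \<and> C \<in> Z \<phi> \<psi>} \<K>"
proof -
  let ?S = "carrier Q" and ?id = "\<lambda>x\<in>carrier Q. x" and ?I = "diff_image Q"
  let ?T = "{(\<phi>, \<psi>, C). \<phi> \<in> X \<and> \<psi> \<in> Y \<phi> \<and> C \<in> Z \<phi> \<psi>}"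
  define R where "R = {(f, g). f \<in> \<K> \<and> g \<in> \<K> \<and> quasigroup_isomorphic ?S f g}"
  have J_auto: "\<phi> \<in> auto Q" if "\<phi> \<in> J" for \<phi>
    using that unfolding J_def by simp
  have id: "\<forall>x\<in>?S. ?id (\<phi> x) = \<phi> (?id x)" if "\<phi> \<in> auto Q" for \<phi>
    using that by simp
  have centralizerD: "\<gamma> \<in> auto Q" "\<forall>x\<in>?S. \<gamma> (\<phi> x) = \<phi> (\<gamma> x)"
    if "\<gamma> \<in> centralizer A \<phi>" "\<phi> \<in> auto Q" for \<gamma> \<phi>
    using that centralizer_iff unfolding A_def by blast+
  have centralizerI: "\<gamma> \<in> centralizer A \<phi>"
    if "\<gamma> \<in> auto Q" "\<forall>x\<in>?S. \<gamma> (\<phi> x) = \<phi> (\<gamma> x)" "\<phi> \<in> auto Q" for \<gamma> \<phi>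
    using that centralizer_iff unfolding A_def by blast
  have conj_iff: "conjugation A F \<gamma> \<psi> = \<psi>' \<longleftrightarrow> (\<forall>x\<in>?S. \<gamma> (\<psi> x) = \<psi>' (\<gamma> x))"
    if "\<gamma> \<in> auto Q" "\<psi> \<in> F" "F \<subseteq> J" "\<psi>' \<in> J" for F \<gamma> \<psi> \<psi>'
    using conjugation_eq_iff[of \<gamma> \<psi> F \<psi>'] that J_auto unfolding A_def by blast
  have XJ: "\<phi> \<in> J" if "\<phi> \<in> X" for \<phi>
    using X that unfolding orbit_representatives_def by blast
  have YE: "\<psi> \<in> E \<phi>" "\<psi> \<in> J" if "\<phi> \<in> X" "\<psi> \<in> Y \<phi>" for \<phi> \<psi>
    using Y E XJ that unfolding orbit_representatives_def by blast+
  have Z_coset: "c \<in> center Q" "C = ?I \<phi> \<psi> #> c"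
    if "\<phi> \<in> X" "\<psi> \<in> Y \<phi>" "C \<in> Z \<phi> \<psi>" "c \<in> C" for \<phi> \<psi> C c
  proof -
    have "C \<in> center_quotient Q (?I \<phi> \<psi>)"
      using Z that unfolding orbit_representatives_def by blast
    then obtain a where a: "a \<in> center Q" "C = ?I \<phi> \<psi> #> a"
      using center_quotient_iff by blast
    have \<phi>\<psi>: "\<phi> \<in> J_central_auto Q" "\<psi> \<in> J_central_auto Q"
      using XJ YE that unfolding J_def by blast+
    show "c \<in> center Q" "C = ?I \<phi> \<psi> #> c"
      using diff_image_coset_center[OF \<phi>\<psi> a(1), of c] diff_image_coset_eq[OF \<phi>\<psi> a(1), of c]
        a(2) that(4) by simp_all
  qed
  have Z_nonempty: "\<exists>c. c \<in> C" if "\<phi> \<in> X" "\<psi> \<in> Y \<phi>" "C \<in> Z \<phi> \<psi>" for \<phi> \<psi> C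
  proof -
    have "C \<in> center_quotient Q (?I \<phi> \<psi>)"
      using Z that unfolding orbit_representatives_def by blast
    then show ?thesis
      using center_quotient_iff diff_image_coset_self XJ YE that unfolding J_def by metis
  qed
  have \<K>I: "affine_op Q \<phi> \<psi> c \<in> \<K>" if "\<phi> \<in> J" "\<psi> \<in> E \<phi>" "c \<in> center Q" for \<phi> \<psi> c
    using that unfolding \<K> by blast
  have \<K>_closed: "f x y \<in> ?S" if f: "f \<in> \<K>" and xy: "x \<in> ?S" "y \<in> ?S" for f x y
  proof -
    obtain \<phi> \<psi> c where "f = affine_op Q \<phi> \<psi> c" "\<phi> \<in> J" "\<psi> \<in> J" "c \<in> center Q"
      using f E unfolding \<K> by blast
    then show ?thesis using xy J_auto by simp
  qed
  have equiv: "equiv \<K> R"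
    unfolding R_def using \<K>_closed by (rule equiv_quasigroup_isomorphic)
  have isoD: "\<exists>\<gamma>\<in>auto Q. (\<forall>x\<in>?S. \<gamma> (\<phi> x) = \<phi>' (\<gamma> x)) \<and> (\<forall>x\<in>?S. \<gamma> (\<psi> x) = \<psi>' (\<gamma> x)) \<and>
      c' \<in> ?I \<phi>' \<psi>' #> \<gamma> c"
    if "(affine_op Q \<phi> \<psi> c, affine_op Q \<phi>' \<psi>' c') \<in> R"
      "\<phi> \<in> J" "\<psi> \<in> J" "\<phi>' \<in> J" "\<psi>' \<in> J" "c \<in> center Q" "c' \<in> center Q" for \<phi> \<psi> c \<phi>' \<psi>' c'
    using that affine_op_isomorphic_iff[of \<phi> \<psi> \<phi>' \<psi>' c c'] J_auto unfolding R_def J_def by blast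
  have isoI: "(affine_op Q \<phi> \<psi> c, affine_op Q \<phi>' \<psi>' c') \<in> R"
    if "\<phi> \<in> J" "\<psi> \<in> E \<phi>" "\<phi>' \<in> J" "\<psi>' \<in> E \<phi>'" "c \<in> center Q" "c' \<in> center Q"
      "\<gamma> \<in> auto Q" "\<forall>x\<in>?S. \<gamma> (\<phi> x) = \<phi>' (\<gamma> x)" "\<forall>x\<in>?S. \<gamma> (\<psi> x) = \<psi>' (\<gamma> x)"
      "c' \<in> ?I \<phi>' \<psi>' #> \<gamma> c" for \<phi> \<psi> c \<phi>' \<psi>' c' \<gamma>
  proof -
    have "\<psi> \<in> J" "\<psi>' \<in> J" using that E by blast+
    then show ?thesis
      using that \<K>I affine_op_isomorphic_iff[of \<phi> \<psi> \<phi>' \<psi>' c c'] J_auto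
      unfolding R_def J_def by blast
  qed
  have same_coset: "(affine_op Q \<phi> \<psi> c, affine_op Q \<phi> \<psi> c') \<in> R"
    if t: "\<phi> \<in> X" "\<psi> \<in> Y \<phi>" "C \<in> Z \<phi> \<psi>" "c \<in> C" "c' \<in> C" for \<phi> \<psi> C c c'
  proof -
    have \<phi>: "\<phi> \<in> J" "\<phi> \<in> auto Q" and \<psi>: "\<psi> \<in> E \<phi>" "\<psi> \<in> auto Q"
      using XJ[OF t(1)] YE[OF t(1,2)] J_auto by blast+
    note cZ = Z_coset[OF t(1-4)] and c'Z = Z_coset[OF t(1-3,5)]
    have "c' \<in> ?I \<phi> \<psi> #> ?id c" using cZ t(5) by simp
    then show ?thesis
      by (rule isoI[OF \<phi>(1) \<psi>(1) \<phi>(1) \<psi>(1) cZ(1) c'Z(1) id_auto id[OF \<phi>(2)] id[OF \<psi>(2)]])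
  qed

  \<comment> \<open>The constant is an arbitrary choice in the coset, harmless by the preceding fact.\<close>
  define F where "F = (\<lambda>(\<phi>, \<psi>, C). R `` {affine_op Q \<phi> \<psi> (SOME c. c \<in> C)})"
  have F: "F (\<phi>, \<psi>, C) = R `` {affine_op Q \<phi> \<psi> c}"
    if "\<phi> \<in> X" "\<psi> \<in> Y \<phi>" "C \<in> Z \<phi> \<psi>" "c \<in> C" for \<phi> \<psi> C c
    using equiv_class_eq[OF equiv same_coset[OF that(1-3) _ that(4), of "SOME c. c \<in> C"]]
      someI[of "\<lambda>c. c \<in> C" c] that(4) unfolding F_def by simp

  have inj: "inj_on F ?T"
  proof (rule inj_onI)
    fix s s' assume "s \<in> ?T" "s' \<in> ?T" and eq': "F s = F s'"
    then obtain \<phi> \<psi> C \<phi>' \<psi>' C' where s: "s = (\<phi>, \<psi>, C)" "s' = (\<phi>', \<psi>', C')"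
      and t: "\<phi> \<in> X" "\<psi> \<in> Y \<phi>" "C \<in> Z \<phi> \<psi>" and t': "\<phi>' \<in> X" "\<psi>' \<in> Y \<phi>'" "C' \<in> Z \<phi>' \<psi>'"
      by blast
    have eq: "F (\<phi>, \<psi>, C) = F (\<phi>', \<psi>', C')" using eq' s by simp
    obtain c c' where c: "c \<in> C" and c': "c' \<in> C'"
      using Z_nonempty t t' by metis
    have cZ: "c \<in> center Q" "C = ?I \<phi> \<psi> #> c" and c'Z: "c' \<in> center Q" "C' = ?I \<phi>' \<psi>' #> c'"
      using Z_coset[OF t c] Z_coset[OF t' c'] by blast+
    have in\<K>: "affine_op Q \<phi>' \<psi>' c' \<in> \<K>"
      using \<K>I XJ YE t' c'Z by blast
    have iso: "(affine_op Q \<phi> \<psi> c, affine_op Q \<phi>' \<psi>' c') \<in> R"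
      using eq F[OF t c] F[OF t' c'] eq_equiv_class[OF _ equiv in\<K>] by simp
    have \<phi>: "\<phi> \<in> J" "\<phi> \<in> auto Q" "\<phi>' \<in> J"
      and \<psi>: "\<psi> \<in> J" "\<psi> \<in> auto Q" "\<psi> \<in> E \<phi>" "\<psi>' \<in> J" "\<psi>' \<in> auto Q"
      using XJ[OF t(1)] XJ[OF t'(1)] YE[OF t(1,2)] YE[OF t'(1,2)] J_auto by blast+
    obtain \<gamma> where \<gamma>: "\<gamma> \<in> auto Q" "\<forall>x\<in>?S. \<gamma> (\<phi> x) = \<phi>' (\<gamma> x)"
        "\<forall>x\<in>?S. \<gamma> (\<psi> x) = \<psi>' (\<gamma> x)" "c' \<in> ?I \<phi>' \<psi>' #> \<gamma> c"
      using isoD[OF iso \<phi>(1) \<psi>(1) \<phi>(3) \<psi>(4) cZ(1) c'Z(1)] by blast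
    have \<phi>_eq: "\<phi> = \<phi>'"
    proof (rule orbit_representatives_unique[OF X t(1) t'(1)])
      show "\<gamma> \<in> carrier A" "?id \<in> carrier A" using \<gamma>(1) id_auto by (simp_all add: A_def)
      show "conjugation A J \<gamma> \<phi> = \<phi>'"
        using conj_iff[OF \<gamma>(1) \<phi>(1) subset_refl \<phi>(3)] \<gamma>(2) by blast
      show "conjugation A J ?id \<phi> = \<phi>"
        using conj_iff[OF id_auto \<phi>(1) subset_refl \<phi>(1)] id[OF \<phi>(2)] by blast
    qed
    have \<gamma>\<phi>: "\<gamma> \<in> centralizer A \<phi>"
      using centralizerI[OF \<gamma>(1) _ \<phi>(2)] \<gamma>(2) \<phi>_eq by blast
    have \<psi>_eq: "\<psi> = \<psi>'"
    proof (rule orbit_representatives_unique[OF Y[rule_format, OF t(1)] t(2)])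
      show "\<psi>' \<in> Y \<phi>" using t'(2) \<phi>_eq by blast
      show "\<gamma> \<in> carrier (A\<lparr>carrier := centralizer A \<phi>\<rparr>)"
        "?id \<in> carrier (A\<lparr>carrier := centralizer A \<phi>\<rparr>)"
        using \<gamma>\<phi> centralizerI[OF id_auto id[OF \<phi>(2)] \<phi>(2)] by (simp_all del: restrict_apply)
      show "conjugation A (E \<phi>) \<gamma> \<psi> = \<psi>'"
        using conj_iff[OF \<gamma>(1) \<psi>(3) E[OF \<phi>(1)] \<psi>(4)] \<gamma>(3) by blast
      show "conjugation A (E \<phi>) ?id \<psi> = \<psi>"
        using conj_iff[OF id_auto \<psi>(3) E[OF \<phi>(1)] \<psi>(1)] id[OF \<psi>(2)] by blast
    qed
    have \<gamma>\<psi>: "\<gamma> \<in> centralizer A \<psi>"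
      using centralizerI[OF \<gamma>(1) _ \<psi>(2)] \<gamma>(3) \<psi>_eq by blast
    note act = quotient_action_coset[OF \<phi>(1)[unfolded J_def] \<psi>(1)[unfolded J_def] cZ(1)]
    have "C = C'"
    proof (rule orbit_representatives_unique[OF Z[rule_format, OF t(1,2)] t(3)])
      show "C' \<in> Z \<phi> \<psi>" using t'(3) \<phi>_eq \<psi>_eq by blast
      show "\<gamma> \<in> carrier (A\<lparr>carrier := centralizer A \<phi> \<inter> centralizer A \<psi>\<rparr>)"
        "?id \<in> carrier (A\<lparr>carrier := centralizer A \<phi> \<inter> centralizer A \<psi>\<rparr>)"
        using \<gamma>\<phi> \<gamma>\<psi> centralizerI[OF id_auto id[OF \<phi>(2)] \<phi>(2)] centralizerI[OF id_auto id[OF \<psi>(2)] \<psi>(2)]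
        by (simp_all del: restrict_apply)
      have "?I \<phi> \<psi> #> c' = ?I \<phi> \<psi> #> \<gamma> c"
        using diff_image_coset_eq[OF \<phi>(1)[unfolded J_def] \<psi>(1)[unfolded J_def]
            auto_center[OF \<gamma>(1) cZ(1)]] \<gamma>(4) \<phi>_eq \<psi>_eq by blast
      moreover have "quotient_action Q (?I \<phi> \<psi>) \<gamma> C = ?I \<phi> \<psi> #> \<gamma> c"
        unfolding cZ(2) using act[OF \<gamma>(1)] \<gamma>(2,3) \<phi>_eq \<psi>_eq by blast
      ultimately show "quotient_action Q (?I \<phi> \<psi>) \<gamma> C = C'"
        using c'Z(2) \<phi>_eq \<psi>_eq by simp
      show "quotient_action Q (?I \<phi> \<psi>) ?id C = C"
        unfolding cZ(2) using act[OF id_auto id[OF \<phi>(2)] id[OF \<psi>(2)]] cZ(1)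
        by (simp add: restrict_apply' del: restrict_apply)
    qed
    then show "s = s'" using s \<phi>_eq \<psi>_eq by simp
  qed

  have into: "F t \<in> \<K> // R" if in_T: "t \<in> ?T" for t
  proof -
    obtain \<phi> \<psi> C where t: "t = (\<phi>, \<psi>, C)" "\<phi> \<in> X" "\<psi> \<in> Y \<phi>" "C \<in> Z \<phi> \<psi>"
      using in_T by blast
    obtain c where c: "c \<in> C" using Z_nonempty[OF t(2-4)] by blast
    show ?thesis
      unfolding t(1) F[OF t(2-4) c]
      by (intro quotientI \<K>I XJ[OF t(2)] YE(1)[OF t(2,3)] Z_coset(1)[OF t(2-4) c])
  qed

  have onto: "\<exists>t\<in>?T. R `` {f} = F t" if f: "f \<in> \<K>" for f
  proof -
    obtain \<phi> \<psi> c where f_eq: "f = affine_op Q \<phi> \<psi> c" and \<phi>: "\<phi> \<in> J" and \<psi>: "\<psi> \<in> E \<phi>"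
      and c: "c \<in> center Q"
      using f unfolding \<K> by blast
    \<comment> \<open>Move the first coefficient into \<open>X\<close>, dragging \<open>\<psi>\<close> along to \<open>\<psi>1\<close>.\<close>
    obtain \<gamma>1 where \<gamma>1: "\<gamma>1 \<in> auto Q" "conjugation A J \<gamma>1 \<phi> \<in> X"
      using orbit_representatives_hit[OF X \<phi>] unfolding A_def by auto
    define \<phi>' where "\<phi>' = conjugation A J \<gamma>1 \<phi>"
    have \<phi>': "\<phi>' \<in> X" "\<phi>' \<in> J" using \<gamma>1 XJ unfolding \<phi>'_def by blast+
    have c1: "\<forall>x\<in>?S. \<gamma>1 (\<phi> x) = \<phi>' (\<gamma>1 x)"
      using conj_iff[OF \<gamma>1(1) \<phi> subset_refl \<phi>'(2)] \<phi>'_def by blast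
    have \<psi>a: "\<psi> \<in> auto Q" using E[OF \<phi>] J_auto \<psi> by blast
    obtain \<psi>1 where \<psi>1: "\<psi>1 \<in> auto Q" "\<forall>x\<in>?S. \<gamma>1 (\<psi> x) = \<psi>1 (\<gamma>1 x)"
      using conjugate_exists[OF \<gamma>1(1) \<psi>a] .
    have \<psi>1E: "\<psi>1 \<in> E \<phi>'" by (rule E_conj[OF \<phi> \<psi> \<phi>'(2) \<psi>1(1) \<gamma>1(1) c1 \<psi>1(2)])
    \<comment> \<open>Move \<open>\<psi>1\<close> into \<open>Y \<phi>'\<close> without disturbing \<open>\<phi>'\<close>.\<close>
    obtain \<gamma>2 where \<gamma>2: "\<gamma>2 \<in> centralizer A \<phi>'" "conjugation A (E \<phi>') \<gamma>2 \<psi>1 \<in> Y \<phi>'"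
      using orbit_representatives_hit[OF Y[rule_format, OF \<phi>'(1)] \<psi>1E] by auto
    define \<psi>' where "\<psi>' = conjugation A (E \<phi>') \<gamma>2 \<psi>1"
    have \<psi>': "\<psi>' \<in> Y \<phi>'" using \<gamma>2 by (simp add: \<psi>'_def)
    have \<psi>'E: "\<psi>' \<in> E \<phi>'" "\<psi>' \<in> J" using YE[OF \<phi>'(1) \<psi>'] .
    have \<gamma>2a: "\<gamma>2 \<in> auto Q" "\<forall>x\<in>?S. \<gamma>2 (\<phi>' x) = \<phi>' (\<gamma>2 x)"
      using centralizerD[OF \<gamma>2(1) J_auto[OF \<phi>'(2)]] .
    have c2: "\<forall>x\<in>?S. \<gamma>2 (\<psi>1 x) = \<psi>' (\<gamma>2 x)"
      using conj_iff[OF \<gamma>2a(1) \<psi>1E E[OF \<phi>'(2)] \<psi>'E(2)] \<psi>'_def by blast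
    \<comment> \<open>By now the constant has become \<open>a\<close>; move its coset without disturbing \<open>\<phi>'\<close> and \<open>\<psi>'\<close>.\<close>
    define a where "a = \<gamma>2 (\<gamma>1 c)"
    have a: "a \<in> center Q" using \<gamma>1 \<gamma>2a c by (simp add: a_def)
    have "?I \<phi>' \<psi>' #> a \<in> center_quotient Q (?I \<phi>' \<psi>')" using a center_quotient_iff by blast
    then obtain \<gamma>3 where \<gamma>3: "\<gamma>3 \<in> centralizer A \<phi>'" "\<gamma>3 \<in> centralizer A \<psi>'"
      "quotient_action Q (?I \<phi>' \<psi>') \<gamma>3 (?I \<phi>' \<psi>' #> a) \<in> Z \<phi>' \<psi>'"
      using orbit_representatives_hit[OF Z[rule_format, OF \<phi>'(1) \<psi>']] by auto
    have \<gamma>3a: "\<gamma>3 \<in> auto Q" "\<forall>x\<in>?S. \<gamma>3 (\<phi>' x) = \<phi>' (\<gamma>3 x)" "\<forall>x\<in>?S. \<gamma>3 (\<psi>' x) = \<psi>' (\<gamma>3 x)"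
      using centralizerD[OF \<gamma>3(1) J_auto[OF \<phi>'(2)]] centralizerD[OF \<gamma>3(2) J_auto[OF \<psi>'E(2)]]
      by blast+
    define C where "C = ?I \<phi>' \<psi>' #> \<gamma>3 a"
    have C: "C \<in> Z \<phi>' \<psi>'"
      using \<gamma>3(3) quotient_action_coset[OF \<phi>'(2)[unfolded J_def] \<psi>'E(2)[unfolded J_def] a \<gamma>3a]
      by (simp add: C_def)
    have g3a: "\<gamma>3 a \<in> center Q" using \<gamma>3a a by simp
    have aC: "\<gamma>3 a \<in> C"
      using diff_image_coset_self[OF \<phi>'(2)[unfolded J_def] \<psi>'E(2)[unfolded J_def] g3a]
      by (simp add: C_def)
    define \<gamma> where "\<gamma> = compose ?S \<gamma>3 (compose ?S \<gamma>2 \<gamma>1)"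
    have \<gamma>: "\<gamma> \<in> auto Q" using \<gamma>1 \<gamma>2a \<gamma>3a by (simp add: \<gamma>_def)
    have \<gamma>_eq: "\<gamma> x = \<gamma>3 (\<gamma>2 (\<gamma>1 x))" if "x \<in> ?S" for x
      using that by (simp add: \<gamma>_def compose_eq)
    have "(f, affine_op Q \<phi>' \<psi>' (\<gamma>3 a)) \<in> R"
      unfolding f_eq
    proof (rule isoI[OF \<phi> \<psi> \<phi>'(2) \<psi>'E(1) c g3a \<gamma>])
      show "\<forall>x\<in>?S. \<gamma> (\<phi> x) = \<phi>' (\<gamma> x)"
        using \<gamma>_eq c1 \<gamma>1(1) \<gamma>2a \<gamma>3a J_auto[OF \<phi>] by simp
      show "\<forall>x\<in>?S. \<gamma> (\<psi> x) = \<psi>' (\<gamma> x)"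
        using \<gamma>_eq c2 \<psi>1 \<gamma>1(1) \<gamma>2a \<gamma>3a \<psi>a by simp
      show "\<gamma>3 a \<in> ?I \<phi>' \<psi>' #> \<gamma> c"
        using aC c \<gamma>_eq by (simp add: C_def a_def)
    qed
    then have "R `` {f} = F (\<phi>', \<psi>', C)"
      using equiv_class_eq[OF equiv] F[OF \<phi>'(1) \<psi>' C aC] by simp
    then show ?thesis using \<phi>' \<psi>' C by blast
  qed

  have "bij_betw F ?T (\<K> // R)"
  proof (rule bij_betw_imageI[OF inj], rule equalityI)
    show "F ` ?T \<subseteq> \<K> // R" using into by blast
    show "\<K> // R \<subseteq> F ` ?T"
    proof
      fix k assume "k \<in> \<K> // R"
      then obtain f where "f \<in> \<K>" "k = R `` {f}" by (rule quotientE)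
      then show "k \<in> F ` ?T" using onto by blast
    qed
  qed
  moreover have "affine_op Q \<phi> \<psi> c \<in> F (\<phi>, \<psi>, C)"
    if "\<phi> \<in> X" "\<psi> \<in> Y \<phi>" "C \<in> Z \<phi> \<psi>" "c \<in> C" for \<phi> \<psi> C c
    using F[OF that] same_coset[OF that that(4)] by simp
  ultimately show ?thesis
    unfolding classifies_def isomorphism_classes_def R_def[symmetric] by blast
qed

section \<open>Centrally affine and trimedial quasigroups\<close>

lemma J_central_auto_central_map:
  "\<phi> \<in> J_central_auto Q \<longleftrightarrow> \<phi> \<in> auto Q \<and> central_map Q (\<lambda>x. inv (\<phi> x))"
  using J_central_auto_iff central_map_inv_iff by blast

lemma centrally_affine_quasigroups_eq:
  "centrally_affine_quasigroups Q = {affine_op Q \<phi> \<psi> c |\<phi> \<psi> c.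
    \<phi> \<in> J_central_auto Q \<and> \<psi> \<in> J_central_auto Q \<and> c \<in> center Q}"
  unfolding centrally_affine_quasigroups_def J_central_auto_central_map
  using affine_op_quasigroup center_carrier by blast

lemma trimedial_quasigroups_eq:
  "trimedial_quasigroups Q = {affine_op Q \<phi> \<psi> c |\<phi> \<psi> c.
    \<phi> \<in> J_central_auto Q \<and> \<psi> \<in> J_central_auto Q \<inter> centralizer (AutoGroup Q) \<phi> \<and> c \<in> center Q}"
proof -
  have "\<psi> \<in> centralizer (AutoGroup Q) \<phi> \<longleftrightarrow>
      compose (carrier Q) \<phi> \<psi> = compose (carrier Q) \<psi> \<phi>"
    if "\<phi> \<in> auto Q" "\<psi> \<in> auto Q" for \<phi> \<psi>
    using that by (auto simp: centralizer_def AutoGroup_mult)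
  then show ?thesis
    unfolding trimedial_quasigroups_def Int_iff J_central_auto_central_map
    using affine_op_quasigroup center_carrier by blast
qed

text \<open>
  Commuting with the first coefficient is preserved when both coefficients are conjugated by the same
  automorphism, so the trimedial condition defines an admissible family of second coefficients.
\<close>

lemma centralizer_conj:
  assumes auto: "\<phi> \<in> auto Q" "\<phi>' \<in> auto Q" "\<psi>' \<in> auto Q" "\<gamma> \<in> auto Q"
    and \<psi>: "\<psi> \<in> centralizer (AutoGroup Q) \<phi>"
    and eq: "\<forall>x\<in>carrier Q. \<gamma> (\<phi> x) = \<phi>' (\<gamma> x)" "\<forall>x\<in>carrier Q. \<gamma> (\<psi> x) = \<psi>' (\<gamma> x)"
  shows "\<psi>' \<in> centralizer (AutoGroup Q) \<phi>'"
proof -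
  have \<psi>: "\<psi> \<in> auto Q" "\<forall>x\<in>carrier Q. \<psi> (\<phi> x) = \<phi> (\<psi> x)"
    using \<psi> centralizer_iff[OF auto(1)] by blast+
  have "\<psi>' (\<phi>' y) = \<phi>' (\<psi>' y)" if y: "y \<in> carrier Q" for y
  proof -
    obtain x where x: "x \<in> carrier Q" "\<gamma> x = y" using auto_surj[OF auto(4) y] .
    have "\<psi>' (\<phi>' (\<gamma> x)) = \<gamma> (\<psi> (\<phi> x))" using eq x(1) auto by simp
    also have "\<dots> = \<gamma> (\<phi> (\<psi> x))" using \<psi> x(1) by simp
    also have "\<dots> = \<phi>' (\<psi>' (\<gamma> x))" using eq x(1) \<psi>(1) by simp
    finally show ?thesis by (simp only: x(2))
  qed
  then show ?thesis using centralizer_iff[OF auto(2)] auto(3) by blast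
qed

end

theorem theorem3p4:
  fixes Q :: "('a, 'b) monoid_scheme"
    and A :: "('a \<Rightarrow> 'a) monoid"
    and X :: "('a \<Rightarrow> 'a) set"
    and Y Y' :: "('a \<Rightarrow> 'a) \<Rightarrow> ('a \<Rightarrow> 'a) set"
    and Z Z' :: "('a \<Rightarrow> 'a) \<Rightarrow> ('a \<Rightarrow> 'a) \<Rightarrow> 'a set set"
  defines "A \<equiv> AutoGroup Q"
  assumes Q: "comm_moufang_loop Q"
    and X: "orbit_representatives A (J_central_auto Q) (conjugation A (J_central_auto Q)) X"
  shows
    "((\<forall>\<phi>\<in>X. orbit_representatives (A\<lparr>carrier := centralizer A \<phi>\<rparr>)
          (J_central_auto Q) (conjugation A (J_central_auto Q)) (Y \<phi>)) \<longrightarrow>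
      (\<forall>\<phi>\<in>X. \<forall>\<psi>\<in>Y \<phi>. orbit_representatives (A\<lparr>carrier := centralizer A \<phi> \<inter> centralizer A \<psi>\<rparr>)
          (center_quotient Q (diff_image Q \<phi> \<psi>)) (quotient_action Q (diff_image Q \<phi> \<psi>)) (Z \<phi> \<psi>)) \<longrightarrow>
      classifies Q {(\<phi>, \<psi>, c). \<phi> \<in> X \<and> \<psi> \<in> Y \<phi> \<and> c \<in> Z \<phi> \<psi>} (centrally_affine_quasigroups Q))
     \<and>
     ((\<forall>\<phi>\<in>X. orbit_representatives (A\<lparr>carrier := centralizer A \<phi>\<rparr>)
          (J_central_auto Q \<inter> centralizer A \<phi>)
          (conjugation A (J_central_auto Q \<inter> centralizer A \<phi>)) (Y' \<phi>)) \<longrightarrow>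
      (\<forall>\<phi>\<in>X. \<forall>\<psi>\<in>Y' \<phi>. orbit_representatives (A\<lparr>carrier := centralizer A \<phi> \<inter> centralizer A \<psi>\<rparr>)
          (center_quotient Q (diff_image Q \<phi> \<psi>)) (quotient_action Q (diff_image Q \<phi> \<psi>)) (Z' \<phi> \<psi>)) \<longrightarrow>
      classifies Q {(\<phi>, \<psi>, c). \<phi> \<in> X \<and> \<psi> \<in> Y' \<phi> \<and> c \<in> Z' \<phi> \<psi>} (trimedial_quasigroups Q))"
proof -
  interpret comm_moufang_loop Q by (rule Q)
  note X' = X[unfolded A_def]
  show ?thesis
    unfolding A_def
  proof (intro conjI impI)
    show "classifies Q {(\<phi>, \<psi>, c). \<phi> \<in> X \<and> \<psi> \<in> Y \<phi> \<and> c \<in> Z \<phi> \<psi>} (centrally_affine_quasigroups Q)"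
      if "\<forall>\<phi>\<in>X. orbit_representatives (AutoGroup Q\<lparr>carrier := centralizer (AutoGroup Q) \<phi>\<rparr>)
          (J_central_auto Q) (conjugation (AutoGroup Q) (J_central_auto Q)) (Y \<phi>)"
        and "\<forall>\<phi>\<in>X. \<forall>\<psi>\<in>Y \<phi>. orbit_representatives
          (AutoGroup Q\<lparr>carrier := centralizer (AutoGroup Q) \<phi> \<inter> centralizer (AutoGroup Q) \<psi>\<rparr>)
          (center_quotient Q (diff_image Q \<phi> \<psi>)) (quotient_action Q (diff_image Q \<phi> \<psi>)) (Z \<phi> \<psi>)"
    proof (rule affine_quasigroups_classified[where E = "\<lambda>_. J_central_auto Q",
          OF _ _ centrally_affine_quasigroups_eq X' that])
      show "\<psi>' \<in> J_central_auto Q"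
        if "\<psi> \<in> J_central_auto Q" "\<psi>' \<in> auto Q" "\<gamma> \<in> auto Q"
          "\<forall>x\<in>carrier Q. \<gamma> (\<psi> x) = \<psi>' (\<gamma> x)" for \<psi> \<psi>' \<gamma>
        using J_central_auto_conj[OF that(1,3,2,4)] .
    qed (rule subset_refl)
    show "classifies Q {(\<phi>, \<psi>, c). \<phi> \<in> X \<and> \<psi> \<in> Y' \<phi> \<and> c \<in> Z' \<phi> \<psi>} (trimedial_quasigroups Q)"
      if "\<forall>\<phi>\<in>X. orbit_representatives (AutoGroup Q\<lparr>carrier := centralizer (AutoGroup Q) \<phi>\<rparr>)
          (J_central_auto Q \<inter> centralizer (AutoGroup Q) \<phi>)
          (conjugation (AutoGroup Q) (J_central_auto Q \<inter> centralizer (AutoGroup Q) \<phi>)) (Y' \<phi>)"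
        and "\<forall>\<phi>\<in>X. \<forall>\<psi>\<in>Y' \<phi>. orbit_representatives
          (AutoGroup Q\<lparr>carrier := centralizer (AutoGroup Q) \<phi> \<inter> centralizer (AutoGroup Q) \<psi>\<rparr>)
          (center_quotient Q (diff_image Q \<phi> \<psi>)) (quotient_action Q (diff_image Q \<phi> \<psi>)) (Z' \<phi> \<psi>)"
    proof (rule affine_quasigroups_classified[where
          E = "\<lambda>\<phi>. J_central_auto Q \<inter> centralizer (AutoGroup Q) \<phi>",
          OF _ _ trimedial_quasigroups_eq X' that])
      show "\<psi>' \<in> J_central_auto Q \<inter> centralizer (AutoGroup Q) \<phi>'"
        if "\<phi> \<in> J_central_auto Q" "\<psi> \<in> J_central_auto Q \<inter> centralizer (AutoGroup Q) \<phi>"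
          "\<phi>' \<in> J_central_auto Q" "\<psi>' \<in> auto Q" "\<gamma> \<in> auto Q"
          "\<forall>x\<in>carrier Q. \<gamma> (\<phi> x) = \<phi>' (\<gamma> x)" "\<forall>x\<in>carrier Q. \<gamma> (\<psi> x) = \<psi>' (\<gamma> x)"
        for \<phi> \<psi> \<phi>' \<psi>' \<gamma>
      proof (rule IntI)
        show "\<psi>' \<in> J_central_auto Q"
          using J_central_auto_conj[OF _ that(5,4,7)] that(2) by blast
        show "\<psi>' \<in> centralizer (AutoGroup Q) \<phi>'"
          using centralizer_conj[OF J_central_auto_auto[OF that(1)] J_central_auto_auto[OF that(3)]
              that(4,5) _ that(6,7)] that(2) by blast
      qed
    qed (rule Int_lower1)
  qed
qed

end
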